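(* Let $n\ge1$, $\delta>0$, $\beta<n+4$, and let $b\in H^{\sigma}(\mathbf{T}^n)$ with $\sigma\in\mathbb{R}$. For $t\ge0$ let $$U(t)=\hat b_0\frac{t^2}{2}+\sum_{0\ne k\in\mathbb{Z}^n}\frac{\hat b_k}{m_k}\left[\cos(\sqrt{-m_k}\,t)-1\right]e^{ik\cdot x}.$$ Then: (1) if $\beta<n$, then $U\in C^\infty([0,\infty),H^q(\mathbf{T}^n))$ for any $q\le\sigma$; (2) if $\beta=n$, then $U\in C^\infty([0,\infty),H^q(\mathbf{T}^n))$ for any $q<\sigma$; (3) if $\beta>n$, then $U\in C^{p+1}([0,\infty),H^q(\mathbf{T}^n))$ for any $q\in\mathbb{R}$ and any positive integer $p$ satisfying $$q-\sigma+(p-1)\frac{\beta-n}{2}\le0 .$$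
   Context: For $k\in\mathbb{Z}^n$, $m_k=m^{\delta,\beta}(k)$, where for $\nu\in\mathbb{R}^n$ $$m^{\delta,\beta}(\nu)=-\|\nu\|^2\,{}_2F_3\!\left(1,\tfrac{n+2-\beta}{2};2,\tfrac{n+2}{2},\tfrac{n+4-\beta}{2};-\tfrac14\|\nu\|^2\delta^2\right),$$ ${}_2F_3(a_1,a_2;b_1,b_2,b_3;z)=\sum_{j\ge0}\frac{(a_1)_j(a_2)_j}{(b_1)_j(b_2)_j(b_3)_j}\frac{z^j}{j!}$, $(a)_j=a(a+1)\cdots(a+j-1)$. For $\beta<n+4$ one has $m_k<0$ for all $k\neq0$. $\mathbf{T}^n=\prod_{j=1}^n[0,2\pi]$ is the periodic torus; a periodic distribution $g$ is written $g=\sum_{k\in\mathbb{Z}^n}\hat g_ke^{ik\cdot x}$ with Fourier coefficients $\hat g_k$; for $q\in\mathbb{R}$, $H^q(\mathbf{T}^n)$ is the space of periodic distributions with $\|g\|_{H^q(\mathbf{T}^n)}^2=\sum_{k\in\mathbb{Z}^n}(1+\|k\|^2)^q|\hat g_k|^2<\infty$. The derivative of a map $T:[0,\infty)\to H^q(\mathbf{T}^n)$ at $t$ is $T'(t)=\lim_{h\to0}\frac{T(t+h)-T(t)}{h}$, the limit being taken in the norm of $H^q(\mathbf{T}^n)$ (one-sided at $t=0$). $C^p([0,\infty),H^q(\mathbf{T}^n))$ denotes the space of maps $[0,\infty)\to H^q(\mathbf{T}^n)$ that are $p$ times differentiable in this sense, and $C^\infty$ means this for all $p$. *)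

theory Defs
  imports "HOL-Analysis.Analysis"
begin

definition hyp2F3 :: "real \<Rightarrow> real \<Rightarrow> real \<Rightarrow> real \<Rightarrow> real \<Rightarrow> real \<Rightarrow> real" where
  "hyp2F3 a1 a2 b1 b2 b3 z =
     (\<Sum>j. (pochhammer a1 j * pochhammer a2 j) /
           (pochhammer b1 j * pochhammer b2 j * pochhammer b3 j) * (z ^ j / fact j))"

definition multiplier :: "real \<Rightarrow> real \<Rightarrow> real ^ 'n::finite \<Rightarrow> real" where
  "multiplier \<delta> \<beta> \<nu> =
     - (norm \<nu>)\<^sup>2 *
       hyp2F3 1 ((real CARD('n) + 2 - \<beta>) / 2)
              2 ((real CARD('n) + 2) / 2) ((real CARD('n) + 4 - \<beta>) / 2)
              (- (1/4) * (norm \<nu>)\<^sup>2 * \<delta>\<^sup>2)"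

definition real_vec :: "int ^ 'n::finite \<Rightarrow> real ^ 'n" where
  "real_vec k = (\<chi> i. real_of_int (k $ i))"

definition torus :: "(real ^ 'n::finite) set" where
  "torus = cbox 0 (\<chi> i. 2 * pi)"

definition character :: "int ^ 'n::finite \<Rightarrow> real ^ 'n \<Rightarrow> complex" where
  "character k x = exp (\<i> * complex_of_real (real_vec k \<bullet> x))"

definition partial :: "'n::finite \<Rightarrow> (real ^ 'n \<Rightarrow> complex) \<Rightarrow> real ^ 'n \<Rightarrow> complex" where
  "partial i f = (\<lambda>x. frechet_derivative f (at x) (axis i 1))"

definition partials :: "'n::finite list \<Rightarrow> (real ^ 'n \<Rightarrow> complex) \<Rightarrow> real ^ 'n \<Rightarrow> complex" where
  "partials js f = foldr partial js f"

definition test_functions :: "(real ^ 'n::finite \<Rightarrow> complex) set" where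
  "test_functions =
     {\<phi>. (\<forall>js. partials js \<phi> differentiable_on UNIV) \<and>
         (\<forall>i x. \<phi> (x + (2 * pi) *\<^sub>R axis i 1) = \<phi> x)}"

definition C_norm :: "nat \<Rightarrow> (real ^ 'n::finite \<Rightarrow> complex) \<Rightarrow> real" where
  "C_norm N \<phi> = (SUP (js, x) \<in> {js. length js \<le> N} \<times> UNIV. norm (partials js \<phi> x))"

text \<open>Periodic distributions are the continuous linear functionals on the smooth periodic
  functions.  Only the values at test functions are meaningful: two functionals that agree on
  \<^term>\<open>test_functions\<close> represent the same distribution.\<close>

type_synonym 'n functional = "(real ^ 'n \<Rightarrow> complex) \<Rightarrow> complex"

definition periodic_distribution :: "'n::finite functional \<Rightarrow> bool" where
  "periodic_distribution g \<longleftrightarrow>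
     (\<forall>\<phi>\<in>test_functions. \<forall>\<psi>\<in>test_functions. g (\<lambda>x. \<phi> x + \<psi> x) = g \<phi> + g \<psi>) \<and>
     (\<forall>\<phi>\<in>test_functions. \<forall>c. g (\<lambda>x. c * \<phi> x) = c * g \<phi>) \<and>
     (\<exists>N C. \<forall>\<phi>\<in>test_functions. norm (g \<phi>) \<le> C * C_norm N \<phi>)"

definition fourier_coeff :: "'n::finite functional \<Rightarrow> int ^ 'n \<Rightarrow> complex" where
  "fourier_coeff g k = g (character (- k)) / complex_of_real ((2 * pi) ^ CARD('n))"

text \<open>A function \<open>f\<close> on the torus is identified with the distribution sending \<open>\<phi>\<close> to the
  integral of \<open>f * \<phi>\<close> over the torus; a trigonometric series is summed in the weak sense,
  that is, after pairing with test functions.\<close>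

definition function_distribution :: "(real ^ 'n::finite \<Rightarrow> complex) \<Rightarrow> 'n functional" where
  "function_distribution f = (\<lambda>\<phi>. integral torus (\<lambda>x. f x * \<phi> x))"

definition trig_series :: "(int ^ 'n::finite \<Rightarrow> complex) \<Rightarrow> 'n functional" where
  "trig_series c = (\<lambda>\<phi>. \<Sum>\<^sub>\<infinity>k. c k * function_distribution (character k) \<phi>)"

definition sobolev :: "real \<Rightarrow> 'n::finite functional set" where
  "sobolev q =
     {g. periodic_distribution g \<and>
         (\<lambda>k. (1 + (norm (real_vec k))\<^sup>2) powr q * (norm (fourier_coeff g k))\<^sup>2) summable_on UNIV}"

definition sobolev_norm :: "real \<Rightarrow> 'n::finite functional \<Rightarrow> real" where
  "sobolev_norm q g =
     sqrt (\<Sum>\<^sub>\<infinity>k. (1 + (norm (real_vec k))\<^sup>2) powr q * (norm (fourier_coeff g k))\<^sup>2)"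

text \<open>Maps on \<open>[0,\<infinity>)\<close> are functions on all reals of which only the values at
  nonnegative arguments are used.  The filter makes the limit one-sided at \<open>t = 0\<close>.\<close>

definition has_sobolev_derivative ::
  "real \<Rightarrow> (real \<Rightarrow> 'n::finite functional) \<Rightarrow> 'n functional \<Rightarrow> real \<Rightarrow> bool" where
  "has_sobolev_derivative q T D t \<longleftrightarrow>
     ((\<lambda>h. sobolev_norm q (\<lambda>\<phi>. (T (t + h) \<phi> - T t \<phi>) / complex_of_real h - D \<phi>))
        \<longlongrightarrow> 0) (at 0 within {h. 0 \<le> t + h})"

primrec C_sobolev :: "nat \<Rightarrow> real \<Rightarrow> (real \<Rightarrow> 'n::finite functional) \<Rightarrow> bool" where
  "C_sobolev 0 q T \<longleftrightarrow> (\<forall>t\<ge>0. T t \<in> sobolev q)"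
| "C_sobolev (Suc p) q T \<longleftrightarrow>
     (\<forall>t\<ge>0. T t \<in> sobolev q) \<and>
     (\<exists>T'. (\<forall>t\<ge>0. has_sobolev_derivative q T (T' t) t) \<and> C_sobolev p q T')"

definition C_infinity_sobolev :: "real \<Rightarrow> (real \<Rightarrow> 'n::finite functional) \<Rightarrow> bool" where
  "C_infinity_sobolev q T \<longleftrightarrow> (\<forall>p. C_sobolev p q T)"

definition solution :: "real \<Rightarrow> real \<Rightarrow> 'n::finite functional \<Rightarrow> real \<Rightarrow> 'n functional" where
  "solution \<delta> \<beta> b t =
     trig_series (\<lambda>k.
       if k = 0 then fourier_coeff b 0 * complex_of_real (t\<^sup>2 / 2)
       else fourier_coeff b k / complex_of_real (multiplier \<delta> \<beta> (real_vec k)) *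
              complex_of_real (cos (sqrt (- multiplier \<delta> \<beta> (real_vec k)) * t) - 1))"

end

(*
  The multipliers enter the solution only through (cos (s t) - 1) / m with s = sqrt (- m), and
  |cos (s t) - 1| <= (s t)^2 / 2, so no lower bound on |m_k| is needed: the first two t-derivatives
  cost nothing and each further one costs a factor |m_k|^(1/2).  Everything rests on the upper bound
  |m(nu)| <= C (1 + |nu|^2)^e with e = max 0 ((beta - n) / 2), where e > 0 is arbitrary if beta = n.

  For that bound put a = (n + 2 - beta) / 2 > -1, mu = n / 2, w = |nu|^2 delta^2 / 4.  The 2F3 series
  S satisfies w (w S' + a S) = a mu (1 - phi), where phi(w) = 0F1(mu; - w) is a Bessel function; since
  mu >= 1/2, an energy argument gives |phi| <= 1.  Hence (w^a S)' = O(w^(a - 2)),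
  and integrating from 1 to w gives the growth of w S.

  On the distribution side, integration by parts on the torus gives the rapid decay of the Fourier
  coefficients of test functions, and the difference quotients converge by dominated convergence in
  the weighted l^2 space.
*)

theory Submission
  imports Defs
begin

subsection \<open>Growth of the multipliers\<close>

text \<open>The choice of operator comes from two quotients in the coefficients of S. Since (a)_j /
  (a+1)_j = a / (a+j), applying w d/dw + a removes the first; since (1)_j / ((2)_j j!) = 1 / (j+1)!,
  one more factor w removes the second, and only a Bessel series is left. The integration starts at
  1 because w^(a-2) fails to be integrable at 0 when a <= 1; on [0,1] continuity of S suffices.
  Integrating w^(a-2) explains the three cases of the theorem: for a > 1 the result is O(w^(a-1)),
  so w S is bounded; for a < 1 it is O(1), so w S = O(w^(1-a)) with 1 - a = (\<beta> - n)/2; at a =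
  1 a logarithm appears, which costs an arbitrarily small power. Regularity count: a factor
  |m_k|^(1/2) is O((1+|k|^2)^(e/2)), that is, a loss of e Sobolev orders. With two free derivatives,
  p + 1 derivatives lose (p - 1) e orders, which is the condition in the third case.\<close>

lemma sums_euler_operator:
  fixes c :: "nat \<Rightarrow> real"
  assumes "\<And>y. summable (\<lambda>n. c n * y ^ n)"
  shows "(\<lambda>n. real n * c n * x ^ n) sums (x * (\<Sum>n. diffs c n * x ^ n))"
proof -
  have "summable (\<lambda>n. diffs c n * x ^ n)"
    by (rule termdiff_converges_all) (rule assms)
  from sums_mult[OF diffs_equiv[OF this], of x]
  have "(\<lambda>n. x * (real n * c n * x ^ (n - Suc 0))) sums (x * (\<Sum>n. diffs c n * x ^ n))" .
  moreover have "x * (real n * c n * x ^ (n - Suc 0)) = real n * c n * x ^ n" for n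
    by (cases n) auto
  ultimately show ?thesis by simp
qed

section \<open>The Bessel function 0F1(\<mu>; -w) and its bound by 1\<close>

definition bessel_coeff :: "real \<Rightarrow> nat \<Rightarrow> real" where
  "bessel_coeff \<mu> j = (-1) ^ j / (fact j * pochhammer \<mu> j)"

text \<open>For w > 0 this equals Gamma(\<mu>) w^((1-\<mu>)/2) J_(\<mu>-1)(2 sqrt w). The borderline
  \<open>\<mu> = 1/2\<close> is cos (2 sqrt w), for which the energy used below is constant.\<close>

definition bessel_series :: "real \<Rightarrow> real \<Rightarrow> real" where
  "bessel_series \<mu> w = (\<Sum>j. bessel_coeff \<mu> j * w ^ j)"

lemma abs_bessel_coeff_le:
  assumes "\<mu> \<ge> 1/2"
  shows "\<bar>bessel_coeff \<mu> j\<bar> \<le> 2 ^ j / fact j"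
proof -
  have "(1/2) ^ j \<le> pochhammer \<mu> j"
    using assms
  proof (induction j)
    case (Suc j)
    have "(1/2) ^ j * (1/2) \<le> pochhammer \<mu> j * (\<mu> + real j)"
      using Suc by (intro mult_mono pochhammer_nonneg) auto
    then show ?case by (simp add: pochhammer_rec' mult.commute)
  qed simp
  moreover have "pochhammer \<mu> j > 0"
    using assms by (intro pochhammer_pos) auto
  ultimately show ?thesis
    by (auto simp: bessel_coeff_def abs_mult power_one_over field_simps)
qed

lemma summable_exp_bound:
  fixes c :: "nat \<Rightarrow> real"
  assumes "\<And>j. \<bar>c j\<bar> \<le> K * (2 ^ j / fact j)"
  shows "summable (\<lambda>j. c j * y ^ j)"
proof (rule summable_comparison_test')
  show "summable (\<lambda>j. K * ((2 * \<bar>y\<bar>) ^ j / fact j))"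
    using summable_mult[OF summable_exp[of "2 * \<bar>y\<bar>"], of K]
    by (simp add: field_simps)
  show "norm (c j * y ^ j) \<le> K * ((2 * \<bar>y\<bar>) ^ j / fact j)" for j
    using mult_right_mono[OF assms[of j], of "\<bar>y\<bar> ^ j"]
    by (simp add: abs_mult power_abs power_mult_distrib)
qed

lemma summable_bessel:
  "\<mu> \<ge> 1/2 \<Longrightarrow> summable (\<lambda>j. bessel_coeff \<mu> j * y ^ j)"
  by (rule summable_exp_bound[of _ 1]) (use abs_bessel_coeff_le in auto)

lemma bessel_coeff_Suc:
  assumes "\<mu> > 0"
  shows "(real j + 1) * (\<mu> + real j) * bessel_coeff \<mu> (Suc j) = - bessel_coeff \<mu> j"
proof -
  have "pochhammer \<mu> j > 0" using assms by (intro pochhammer_pos)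
  then show ?thesis
    using assms by (simp add: bessel_coeff_def pochhammer_rec' divide_simps)
qed

text \<open>\<open>\<phi> = bessel_series \<mu>\<close> solves \<open>w \<phi>'' + \<mu> \<phi>' + \<phi> = 0\<close>, so the energy
  \<open>\<phi>\<^sup>2 + w \<phi>'\<^sup>2\<close> has derivative \<open>(1 - 2 \<mu>) \<phi>'\<^sup>2 \<le> 0\<close>.\<close>

lemma abs_bessel_series_le_1:
  assumes \<mu>: "\<mu> \<ge> 1/2" and w: "w \<ge> 0"
  shows "\<bar>bessel_series \<mu> w\<bar> \<le> 1"
proof -
  define p where "p = bessel_coeff \<mu>"
  define f where "f = bessel_series \<mu>"
  define f' where "f' = (\<lambda>w::real. \<Sum>j. diffs p j * w ^ j)"
  define f'' where "f'' = (\<lambda>w::real. \<Sum>j. diffs (diffs p) j * w ^ j)"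
  have s0: "summable (\<lambda>j. p j * y ^ j)" for y
    unfolding p_def using \<mu> by (rule summable_bessel)
  have s1: "summable (\<lambda>j. diffs p j * y ^ j)" for y
    by (rule termdiff_converges_all) (rule s0)
  have d0: "(f has_field_derivative f' x) (at x)" for x
    unfolding f_def f'_def bessel_series_def p_def[symmetric]
    by (rule termdiffs_strong_converges_everywhere) (rule s0)
  have d1: "(f' has_field_derivative f'' x) (at x)" for x
    unfolding f'_def f''_def by (rule termdiffs_strong_converges_everywhere) (rule s1)
  have ode: "x * f'' x + \<mu> * f' x + f x = 0" for x
  proof -
    have "(\<lambda>j. real j * diffs p j * x ^ j + \<mu> * (diffs p j * x ^ j) + p j * x ^ j)
            sums (x * f'' x + \<mu> * f' x + f x)"
      unfolding f''_def f'_def f_def bessel_series_def p_def[symmetric]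
      by (intro sums_add sums_mult sums_euler_operator s1 summable_sums s0)
    moreover have "real j * diffs p j * x ^ j + \<mu> * (diffs p j * x ^ j) + p j * x ^ j = 0" for j
    proof -
      have "real j * diffs p j + \<mu> * diffs p j + p j = 0"
        using bessel_coeff_Suc[of \<mu> j] \<mu> by (simp add: diffs_def p_def algebra_simps)
      then show ?thesis by (metis distrib_right mult.assoc mult_zero_left)
    qed
    ultimately show ?thesis by (simp add: sums_iff)
  qed
  have energy: "\<exists>y. ((\<lambda>x. (f x)\<^sup>2 + x * (f' x)\<^sup>2) has_real_derivative y) (at x) \<and> y \<le> 0" for x
  proof (intro exI conjI)
    show "((\<lambda>x. (f x)\<^sup>2 + x * (f' x)\<^sup>2) has_real_derivative
        2 * f x * f' x + (f' x)\<^sup>2 + 2 * (x * f'' x) * f' x) (at x)"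
      by (auto intro!: derivative_eq_intros d0 d1 simp: algebra_simps power2_eq_square)
    have "x * f'' x = - \<mu> * f' x - f x" using ode[of x] by linarith
    then have "2 * f x * f' x + (f' x)\<^sup>2 + 2 * (x * f'' x) * f' x = (1 - 2 * \<mu>) * (f' x)\<^sup>2"
      by (simp only:) (simp add: algebra_simps power2_eq_square)
    also have "\<dots> \<le> 0" using \<mu> by (intro mult_nonpos_nonneg) auto
    finally show "2 * f x * f' x + (f' x)\<^sup>2 + 2 * (x * f'' x) * f' x \<le> 0" .
  qed
  have "(f w)\<^sup>2 + w * (f' w)\<^sup>2 \<le> (f 0)\<^sup>2 + 0 * (f' 0)\<^sup>2"
    using w energy by (intro DERIV_nonpos_imp_nonincreasing[of 0 w]) blast+
  moreover have "f 0 = 1"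
    by (simp only: f_def bessel_series_def powser_zero) (simp add: bessel_coeff_def)
  ultimately have "(f w)\<^sup>2 \<le> 1"
    using mult_nonneg_nonneg[OF w zero_le_power2[of "f' w"]] by simp
  then show ?thesis by (simp add: f_def abs_square_le_1)
qed

section \<open>The 2F3 series and its first-order differential equation\<close>

definition multiplier_coeff :: "real \<Rightarrow> real \<Rightarrow> nat \<Rightarrow> real" where
  "multiplier_coeff a \<mu> j =
     (-1) ^ j * pochhammer a j / (pochhammer (a + 1) j * (fact (Suc j) * pochhammer (\<mu> + 1) j))"

text \<open>The factor a + j cancels because (a + j) (a)_j = a (a+1)_j, and (\<mu>)_(j+1) = \<mu>
  (\<mu>+1)_j matches the rest. The product form also covers a = 0, where a + j vanishes at j =
  0.\<close>

lemma multiplier_coeff_recurrence: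
  assumes "a > -1" and "\<mu> > 0"
  shows "(a + real j) * multiplier_coeff a \<mu> j = - (a * \<mu>) * bessel_coeff \<mu> (Suc j)"
proof -
  have key: "A * (s * P / (Q * (f * R))) = - (a * \<mu>) * (- s / (f * (\<mu> * R)))"
    if "A * P = a * Q" "Q > 0" "R > 0" "f > 0" for A s P Q f R :: real
  proof -
    have "A * (s * P / (Q * (f * R))) = s * (A * P) / (Q * (f * R))" by simp
    also have "\<dots> = s * a / (f * R)" using that by simp
    also have "\<dots> = - (a * \<mu>) * (- s / (f * (\<mu> * R)))" using \<open>\<mu> > 0\<close> that by simp
    finally show ?thesis .
  qed
  have h: "(a + real j) * pochhammer a j = a * pochhammer (a + 1) j"
    by (metis pochhammer_rec pochhammer_rec')
  have pos: "pochhammer (a + 1) j > 0" "pochhammer (\<mu> + 1) j > 0"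
    using assms by (intro pochhammer_pos; simp)+
  have "bessel_coeff \<mu> (Suc j) = - ((-1) ^ j) / (fact (Suc j) * (\<mu> * pochhammer (\<mu> + 1) j))"
    unfolding bessel_coeff_def by (simp only: pochhammer_rec power_Suc mult_minus1)
  then show ?thesis
    unfolding multiplier_coeff_def by (simp only: key[OF h pos fact_gt_zero])
qed

lemma summable_multiplier_coeff:
  assumes a: "a > -1" and \<mu>: "\<mu> \<ge> 1/2"
  shows "summable (\<lambda>j. multiplier_coeff a \<mu> j * y ^ j)"
proof (rule summable_exp_bound)
  fix j
  \<comment> \<open>The 2 absorbs the surplus factor of 2^(j+1). The maximum with 1 covers j = 0,
    where the coefficient is 1 and a + j may fail to be positive.\<close>
  define K where "K = max 1 (\<bar>a\<bar> / (a + 1) * (2 * \<mu>))"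
  show "\<bar>multiplier_coeff a \<mu> j\<bar> \<le> K * (2 ^ j / fact j)"
  proof (cases j)
    case 0
    then show ?thesis by (simp add: multiplier_coeff_def K_def)
  next
    case (Suc i)
    have "\<bar>multiplier_coeff a \<mu> j\<bar> = \<bar>a\<bar> / (a + j) * \<mu> * \<bar>bessel_coeff \<mu> (Suc j)\<bar>"
    proof -
      have "\<bar>(a + real j) * multiplier_coeff a \<mu> j\<bar> = \<bar>(a * \<mu>) * bessel_coeff \<mu> (Suc j)\<bar>"
        using multiplier_coeff_recurrence[of a \<mu> j] a \<mu> by simp
      moreover have pos: "a + real j > 0" using a Suc by simp
      ultimately have "(a + real j) * \<bar>multiplier_coeff a \<mu> j\<bar> = \<bar>a\<bar> * \<mu> * \<bar>bessel_coeff \<mu> (Suc j)\<bar>"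
        using \<mu> by (simp only: abs_mult)
      then show ?thesis using pos by (simp add: field_simps)
    qed
    also have "\<dots> \<le> \<bar>a\<bar> / (a + 1) * \<mu> * (2 ^ Suc j / fact (Suc j))"
      using a \<mu> Suc by (intro mult_mono frac_le abs_bessel_coeff_le divide_nonneg_nonneg) auto
    also have "\<dots> = (\<bar>a\<bar> / (a + 1) * (2 * \<mu>)) * (2 ^ j / fact (Suc j))" by simp
    also have "\<dots> \<le> K * (2 ^ j / fact j)"
      using a \<mu> by (intro mult_mono frac_le fact_mono) (auto simp: K_def)
    finally show ?thesis .
  qed
qed

definition multiplier_series :: "real \<Rightarrow> real \<Rightarrow> real \<Rightarrow> real" where
  "multiplier_series a \<mu> w = (\<Sum>j. multiplier_coeff a \<mu> j * w ^ j)"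

text \<open>On w^j the operator w d/dw + a is multiplication by a + j, so the recurrence applies
  termwise. The outer factor w raises the power to j + 1, which produces the Bessel series without
  its constant term 1.\<close>

lemma multiplier_series_derivative:
  assumes a: "a > -1" and \<mu>: "\<mu> \<ge> 1/2"
  obtains S' where "\<And>w. (multiplier_series a \<mu> has_real_derivative S' w) (at w)"
    and "\<And>w. w * (w * S' w + a * multiplier_series a \<mu> w) = a * \<mu> * (1 - bessel_series \<mu> w)"
proof
  define s where "s = multiplier_coeff a \<mu>"
  define S' where "S' = (\<lambda>w::real. \<Sum>j. diffs s j * w ^ j)"
  have sm: "summable (\<lambda>j. s j * y ^ j)" for y
    unfolding s_def using a \<mu> by (rule summable_multiplier_coeff)
  show "(multiplier_series a \<mu> has_real_derivative S' w) (at w)" for w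
    unfolding multiplier_series_def s_def[symmetric] S'_def
    by (rule termdiffs_strong_converges_everywhere) (rule sm)
  show "w * (w * S' w + a * multiplier_series a \<mu> w) = a * \<mu> * (1 - bessel_series \<mu> w)" for w
  proof -
    have "(\<lambda>j. w * (real j * s j * w ^ j + a * (s j * w ^ j)))
            sums (w * (w * S' w + a * multiplier_series a \<mu> w))"
      unfolding S'_def multiplier_series_def s_def[symmetric]
      by (intro sums_add sums_mult sums_euler_operator sm summable_sums)
    moreover have "w * (real j * s j * w ^ j + a * (s j * w ^ j)) =
        - (a * \<mu>) * (bessel_coeff \<mu> (Suc j) * w ^ Suc j)" for j
    proof -
      have "w * (real j * s j * w ^ j + a * (s j * w ^ j)) = ((a + real j) * s j) * w ^ Suc j"
        by (simp add: algebra_simps)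
      then show ?thesis
        unfolding s_def using multiplier_coeff_recurrence[of a \<mu> j] a \<mu> by simp
    qed
    moreover have "(\<lambda>j. - (a * \<mu>) * (bessel_coeff \<mu> (Suc j) * w ^ Suc j)) sums
        (- (a * \<mu>) * (bessel_series \<mu> w - bessel_coeff \<mu> 0 * w ^ 0))"
      unfolding bessel_series_def
      by (intro sums_mult)
         (subst sums_Suc_iff, simp add: summable_sums[OF summable_bessel[OF \<mu>]])
    ultimately have "w * (w * S' w + a * multiplier_series a \<mu> w) =
        - (a * \<mu>) * (bessel_series \<mu> w - bessel_coeff \<mu> 0 * w ^ 0)"
      by (simp add: sums_iff)
    then show ?thesis by (simp add: bessel_coeff_def algebra_simps)
  qed
qed

text \<open>K (x^s - 1)/s is the antiderivative of the bound that vanishes at 1. Subtracting it from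
  F gives a nonincreasing function, adding it a nondecreasing one.\<close>

lemma bound_from_powr_derivative:
  fixes F F' :: "real \<Rightarrow> real"
  assumes der: "\<And>x. x \<ge> 1 \<Longrightarrow> (F has_real_derivative F' x) (at x)"
    and bd: "\<And>x. x \<ge> 1 \<Longrightarrow> \<bar>F' x\<bar> \<le> K * x powr (s - 1)"
    and "s \<noteq> 0" "w \<ge> 1"
  shows "\<bar>F w\<bar> \<le> \<bar>F 1\<bar> + K * ((w powr s - 1) / s)"
proof -
  have P: "((\<lambda>x. K * ((x powr s - 1) / s)) has_real_derivative K * x powr (s - 1)) (at x)"
    if "x \<ge> 1" for x
    using that \<open>s \<noteq> 0\<close> by (auto intro!: derivative_eq_intros)
  have "F w - K * ((w powr s - 1) / s) \<le> F 1 - K * ((1 powr s - 1) / s)"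
  proof (rule DERIV_nonpos_imp_nonincreasing[OF \<open>w \<ge> 1\<close>])
    fix x :: real assume "1 \<le> x"
    then show "\<exists>y. ((\<lambda>x. F x - K * ((x powr s - 1) / s)) has_real_derivative y) (at x) \<and> y \<le> 0"
      using bd[of x] by (intro exI[of _ "F' x - K * x powr (s - 1)"] conjI DERIV_diff der P) auto
  qed
  moreover have "F 1 + K * ((1 powr s - 1) / s) \<le> F w + K * ((w powr s - 1) / s)"
  proof (rule DERIV_nonneg_imp_nondecreasing[OF \<open>w \<ge> 1\<close>])
    fix x :: real assume "1 \<le> x"
    then show "\<exists>y. ((\<lambda>x. F x + K * ((x powr s - 1) / s)) has_real_derivative y) (at x) \<and> 0 \<le> y"
      using bd[of x] by (intro exI[of _ "F' x + K * x powr (s - 1)"] conjI DERIV_add der P) auto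
  qed
  ultimately show ?thesis by simp
qed

lemma multiplier_series_growth:
  assumes a: "a > -1" and \<mu>: "\<mu> \<ge> 1/2"
    and e: "e \<ge> 0" "e \<ge> 1 - a" "a = 1 \<Longrightarrow> e > 0"
  shows "\<exists>C. \<forall>w\<ge>0. \<bar>w * multiplier_series a \<mu> w\<bar> \<le> C * (1 + w powr e)"
proof -
  define S where "S = multiplier_series a \<mu>"
  obtain S' where S': "\<And>w. (S has_real_derivative S' w) (at w)"
    and eq: "\<And>w. w * (w * S' w + a * S w) = a * \<mu> * (1 - bessel_series \<mu> w)"
    using multiplier_series_derivative[OF a \<mu>] unfolding S_def by metis
  define K where "K = 2 * \<bar>a\<bar> * \<mu>"
  have K: "K \<ge> 0" using \<mu> by (simp add: K_def)
  \<comment> \<open>The bound on F' is a multiple of x^(a-2), so s = a - 1 is the natural exponent.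
    At a = 1 this would be 0 and the antiderivative a logarithm; the larger exponent e > 0 keeps it
    a power. Either way s <= a - 1 + e, the growth wanted for F.\<close>
  define s where "s = (if a = 1 then e else a - 1)"
  have s: "s \<noteq> 0" "s \<ge> a - 1" "s \<le> a - 1 + e"
    using e by (auto simp: s_def)
  define F where "F = (\<lambda>w. w powr a * S w)"
  define F' where "F' = (\<lambda>w. w powr (a - 1) * (w * S' w + a * S w))"
  have F: "(F has_real_derivative F' x) (at x)" if "x \<ge> 1" for x
  proof -
    have d: "(F has_real_derivative a * x powr (a - 1) * S x + S' x * x powr a) (at x)"
      unfolding F_def using that by (intro DERIV_mult has_real_derivative_powr S') auto
    have p: "x powr a = x powr (a - 1) * x" using that by (simp add: powr_diff)
    have "a * p * s + s' * (p * x) = p * (x * s' + a * s)" for p s s' :: real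
      by (simp add: algebra_simps)
    then have "a * x powr (a - 1) * S x + S' x * x powr a = F' x"
      unfolding F'_def p .
    with d show ?thesis by simp
  qed
  have F'bd: "\<bar>F' x\<bar> \<le> K * x powr (s - 1)" if "x \<ge> 1" for x
  proof -
    \<comment> \<open>The differential equation carries one factor w more than F', hence the drop
      from a - 1 to a - 2.\<close>
    have "F' x = x powr (a - 2) * (x * (x * S' x + a * S x))"
      unfolding F'_def using that by (simp add: powr_diff power2_eq_square)
    then have "F' x = x powr (a - 2) * (a * \<mu> * (1 - bessel_series \<mu> x))" by (simp only: eq)
    then have "\<bar>F' x\<bar> = x powr (a - 2) * (\<bar>a\<bar> * \<mu> * \<bar>1 - bessel_series \<mu> x\<bar>)"
      using \<mu> by (simp add: abs_mult)
    also have "\<dots> \<le> x powr (s - 1) * (\<bar>a\<bar> * \<mu> * 2)"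
      using that \<mu> s abs_bessel_series_le_1[OF \<mu>, of x]
      by (intro mult_mono powr_mono mult_left_mono mult_nonneg_nonneg) auto
    finally show ?thesis by (simp add: K_def mult_ac)
  qed
  \<comment> \<open>For s < 0 the quotient stays below 1/|s|, and since a - 1 + e >= 0 the power on
    the right is at least 1.\<close>
  have powr_frac: "(w powr s - 1) / s \<le> (1 / \<bar>s\<bar>) * w powr (a - 1 + e)" if "w \<ge> 1" for w
  proof (cases "s > 0")
    case True
    have "w powr s - 1 \<le> w powr (a - 1 + e)"
      using powr_mono[of s "a - 1 + e" w] that s by linarith
    then show ?thesis using True by (simp add: divide_right_mono)
  next
    case False
    have "1 \<le> w powr (a - 1 + e)"
      using that e s by (intro ge_one_powr_ge_zero) auto
    moreover have "w powr s \<ge> 0" by simp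
    ultimately have "1 - w powr s \<le> w powr (a - 1 + e)" by linarith
    then have "(1 - w powr s) / \<bar>s\<bar> \<le> w powr (a - 1 + e) / \<bar>s\<bar>"
      by (intro divide_right_mono) auto
    moreover have "(1 - w powr s) / \<bar>s\<bar> = (w powr s - 1) / s"
      using False s by (simp add: divide_simps)
    ultimately show ?thesis by simp
  qed
  define C1 where "C1 = \<bar>F 1\<bar> + K * (1 / \<bar>s\<bar>)"
  have large: "\<bar>w * S w\<bar> \<le> C1 * w powr e" if w: "w \<ge> 1" for w
  proof -
    have "\<bar>F w\<bar> \<le> \<bar>F 1\<bar> + K * ((w powr s - 1) / s)"
      using F F'bd s(1) w by (rule bound_from_powr_derivative)
    also have "\<dots> \<le> \<bar>F 1\<bar> * w powr (a - 1 + e) + K * ((1 / \<bar>s\<bar>) * w powr (a - 1 + e))"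
    proof (intro add_mono mult_left_mono powr_frac w K)
      have "1 \<le> w powr (a - 1 + e)"
        using w e by (intro ge_one_powr_ge_zero) auto
      then show "\<bar>F 1\<bar> \<le> \<bar>F 1\<bar> * w powr (a - 1 + e)"
        using mult_left_mono[of 1 "w powr (a - 1 + e)" "\<bar>F 1\<bar>"] by simp
    qed
    also have "\<dots> = C1 * w powr (a - 1 + e)"
      by (simp add: C1_def algebra_simps)
    finally have Fw: "\<bar>F w\<bar> \<le> C1 * w powr (a - 1 + e)" .
    have "w * S w = w powr (1 - a) * F w"
      using w by (simp add: F_def powr_diff)
    then have "\<bar>w * S w\<bar> = w powr (1 - a) * \<bar>F w\<bar>" by (simp add: abs_mult)
    also have "\<dots> \<le> w powr (1 - a) * (C1 * w powr (a - 1 + e))"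
      using Fw by (intro mult_left_mono) auto
    also have "\<dots> = C1 * (w powr (1 - a) * w powr (a - 1 + e))" by (simp only: mult_ac)
    also have "w powr (1 - a) * w powr (a - 1 + e) = w powr e"
      unfolding powr_add[symmetric] by (rule arg_cong[where f = "(powr) w"]) simp
    finally show ?thesis .
  qed
  have "continuous_on {0..1} (\<lambda>w. w * S w)"
    by (intro continuous_intros) (rule DERIV_continuous_on[OF has_field_derivative_at_within[OF S']])
  then obtain C0 where C0: "\<And>w. w \<in> {0..1} \<Longrightarrow> \<bar>w * S w\<bar> \<le> C0"
    using compact_imp_bounded[OF compact_continuous_image[OF _ compact_Icc]]
    by (fastforce simp: bounded_iff)
  have "C0 \<ge> 0" using C0[of 0] by simp
  have "C1 \<ge> 0" using K by (simp add: C1_def)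
  have "\<bar>w * S w\<bar> \<le> (C0 + C1) * (1 + w powr e)" if "w \<ge> 0" for w
  proof -
    have "0 \<le> C0 * w powr e" "0 \<le> C1 * w powr e" using \<open>C0 \<ge> 0\<close> \<open>C1 \<ge> 0\<close> by auto
    moreover have "(C0 + C1) * (1 + w powr e) = C0 + C1 + C0 * w powr e + C1 * w powr e"
      by (simp add: distrib_left distrib_right)
    moreover have "\<bar>w * S w\<bar> \<le> C0 \<or> \<bar>w * S w\<bar> \<le> C1 * w powr e"
      using large[of w] C0[of w] that by (cases "w \<le> 1") auto
    ultimately show ?thesis using \<open>C0 \<ge> 0\<close> \<open>C1 \<ge> 0\<close> by linarith
  qed
  then show ?thesis unfolding S_def by blast
qed

lemma multiplier_eq_series:
  fixes \<nu> :: "real ^ 'n::finite"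
  assumes "\<beta> < real CARD('n) + 4"
  shows "multiplier \<delta> \<beta> \<nu> = - (norm \<nu>)\<^sup>2 *
    multiplier_series ((real CARD('n) + 2 - \<beta>) / 2) (real CARD('n) / 2) ((norm \<nu>)\<^sup>2 * \<delta>\<^sup>2 / 4)"
proof -
  let ?a = "(real CARD('n) + 2 - \<beta>) / 2" and ?\<mu> = "real CARD('n) / 2"
    and ?w = "(norm \<nu>)\<^sup>2 * \<delta>\<^sup>2 / 4"
  have 1: "(real CARD('n) + 4 - \<beta>) / 2 = ?a + 1" "(real CARD('n) + 2) / 2 = ?\<mu> + 1"
    "- (1/4) * (norm \<nu>)\<^sup>2 * \<delta>\<^sup>2 = - ?w"
    by (simp_all add: field_simps)
  have 2: "pochhammer (2::real) j = fact (Suc j)" for j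
    using pochhammer_rec[of "1::real" j] by (simp add: pochhammer_fact[symmetric])
  have 3: "f * A / (F * M * B) * ((- w) ^ j / f) = (-1) ^ j * A / (B * (F * M)) * w ^ j"
    if "f \<noteq> 0" for f A F M B w :: real and j
    using that by (simp add: power_minus[of w] mult_ac)
  have "hyp2F3 1 ?a 2 (?\<mu> + 1) (?a + 1) (- ?w) = multiplier_series ?a ?\<mu> ?w"
    unfolding hyp2F3_def multiplier_series_def multiplier_coeff_def 2 pochhammer_fact[symmetric]
    by (intro suminf_cong 3 fact_nonzero)
  then show ?thesis unfolding multiplier_def 1 by simp
qed

text \<open>The parameters translate by 1 - a = (\<beta> - n)/2: a = 1 means \<beta> = n, and a > -1
  means \<beta> < n + 4.\<close>

lemma multiplier_growth:
  assumes \<delta>: "\<delta> > 0" and \<beta>: "\<beta> < real CARD('n::finite) + 4"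
    and e: "e \<ge> 0" "e \<ge> (\<beta> - real CARD('n)) / 2" "\<beta> = real CARD('n) \<Longrightarrow> e > 0"
  obtains C where "C \<ge> 0" "\<And>\<nu> :: real ^ 'n. \<bar>multiplier \<delta> \<beta> \<nu>\<bar> \<le> C * (1 + (norm \<nu>)\<^sup>2) powr e"
proof -
  let ?a = "(real CARD('n) + 2 - \<beta>) / 2" and ?\<mu> = "real CARD('n) / 2"
  have "CARD('n) \<ge> 1" by (simp add: Suc_leI)
  then have "?\<mu> \<ge> 1/2" by simp
  moreover have "?a > -1" using \<beta> by (simp add: field_simps)
  moreover have "e \<ge> 1 - ?a" "?a = 1 \<Longrightarrow> e > 0" using e by (auto simp: field_simps)
  ultimately obtain C where C: "\<And>w. w \<ge> 0 \<Longrightarrow> \<bar>w * multiplier_series ?a ?\<mu> w\<bar> \<le> C * (1 + w powr e)"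
    using multiplier_series_growth[of ?a ?\<mu> e] e(1) by metis
  have "C \<ge> 0" using C[of 0] by (simp split: if_splits)
  \<comment> \<open>4/\<delta>^2 turns |\<nu>|^2 into w; the other factor comes from comparing 1 +
    w^e with (1 + |\<nu>|^2)^e.\<close>
  define D where "D = 4 / \<delta>\<^sup>2 * (C * (1 + (\<delta>\<^sup>2 / 4) powr e))"
  show ?thesis
  proof
    show "D \<ge> 0" using \<open>C \<ge> 0\<close> by (simp add: D_def)
    fix \<nu> :: "real ^ 'n"
    let ?W = "1 + (norm \<nu>)\<^sup>2" and ?w = "(norm \<nu>)\<^sup>2 * \<delta>\<^sup>2 / 4"
    have "\<bar>multiplier \<delta> \<beta> \<nu>\<bar> = 4 / \<delta>\<^sup>2 * \<bar>?w * multiplier_series ?a ?\<mu> ?w\<bar>"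
      using \<delta> by (simp add: multiplier_eq_series[OF \<beta>] abs_mult)
    also have "\<dots> \<le> 4 / \<delta>\<^sup>2 * (C * (1 + ?w powr e))"
      by (intro mult_left_mono C) auto
    also have "\<dots> \<le> 4 / \<delta>\<^sup>2 * (C * (?W powr e + (\<delta>\<^sup>2 / 4) powr e * ?W powr e))"
    proof (intro mult_left_mono add_mono \<open>C \<ge> 0\<close>)
      show "1 \<le> ?W powr e" using e by (intro ge_one_powr_ge_zero) auto
      have "?w powr e \<le> (\<delta>\<^sup>2 / 4 * ?W) powr e"
        using e by (intro powr_mono2) (auto simp: field_simps)
      then show "?w powr e \<le> (\<delta>\<^sup>2 / 4) powr e * ?W powr e"
        by (subst (asm) powr_mult) auto
    qed auto
    also have "\<dots> = D * ?W powr e" by (simp add: D_def algebra_simps)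
    finally show "\<bar>multiplier \<delta> \<beta> \<nu>\<bar> \<le> D * ?W powr e" .
  qed
qed

subsection \<open>Fourier coefficients of test functions\<close>

lemma norm_real_vec_sq:
  "(norm (real_vec k))\<^sup>2 = (\<Sum>i\<in>UNIV. (real_of_int (k $ i))\<^sup>2)"
  unfolding power2_norm_eq_inner by (simp add: real_vec_def inner_vec_def power2_eq_square)

lemma component_sq_le_norm_real_vec_sq:
  "(real_of_int (k $ i))\<^sup>2 \<le> (norm (real_vec k))\<^sup>2"
  unfolding norm_real_vec_sq by (rule member_le_sum) auto

lemma summable_on_int_inverse_square:
  "(\<lambda>x::int. 1 / (1 + (real_of_int x)\<^sup>2)) summable_on UNIV"
proof -
  have "summable (\<lambda>n. norm (1 / (1 + (real n)\<^sup>2)))"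
  proof (rule summable_comparison_test_ev[OF _ inverse_power_summable[of 2]])
    show "\<forall>\<^sub>F n in sequentially. norm (norm (1 / (1 + (real n)\<^sup>2))) \<le> inverse ((real n)\<^sup>2)"
      using eventually_gt_at_top[of 0]
      by eventually_elim (simp add: inverse_eq_divide frac_le)
  qed simp
  then have *: "(\<lambda>n. 1 / (1 + (real n)\<^sup>2)) summable_on UNIV"
    by (rule norm_summable_imp_summable_on)
  have "(\<lambda>x::int. 1 / (1 + (real_of_int x)\<^sup>2)) summable_on range int"
    using * by (subst summable_on_reindex) (auto simp: o_def)
  moreover have "(\<lambda>x::int. 1 / (1 + (real_of_int x)\<^sup>2)) summable_on range (\<lambda>n. - int n)"
    using * by (subst summable_on_reindex) (auto simp: o_def inj_def)
  moreover have "range int \<union> range (\<lambda>n. - int n) = UNIV"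
    by (auto simp: image_iff) (metis int_cases2)
  ultimately show ?thesis
    using summable_on_union by metis
qed

text \<open>As 1 + |k|^2 dominates every 1 + k_i^2, its n-th power dominates their product, and the
  sum of the reciprocal products factors into convergent one-dimensional sums.\<close>

lemma summable_on_lattice:
  "(\<lambda>k::int ^ 'n::finite. (1 + (norm (real_vec k))\<^sup>2) powr (- real CARD('n))) summable_on UNIV"
proof -
  let ?f = "\<lambda>k::int ^ 'n. \<Prod>i\<in>UNIV. 1 / (1 + (real_of_int (k $ i))\<^sup>2)"
  have "Infinite_Set_Sum.abs_summable_on (\<lambda>g::'n \<Rightarrow> int. \<Prod>i\<in>UNIV. 1 / (1 + (real_of_int (g i))\<^sup>2))
      (PiE UNIV (\<lambda>_. UNIV))"
    using summable_on_int_inverse_square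
    by (intro abs_summable_on_prod_PiE abs_summable_equivalent[THEN iffD1]) simp_all
  then have "(\<lambda>g::'n \<Rightarrow> int. \<Prod>i\<in>UNIV. 1 / (1 + (real_of_int (g i))\<^sup>2)) summable_on UNIV"
    using abs_summable_equivalent abs_summable_summable by (metis PiE_UNIV_domain Pi_UNIV UNIV_I)
  moreover have "bij_betw (\<lambda>k i. k $ i) (UNIV :: (int ^ 'n) set) UNIV"
    by (rule bij_betwI[where g = vec_lambda]) auto
  ultimately have "?f summable_on UNIV"
    using summable_on_reindex_bij_betw
      [of "\<lambda>k i. k $ i" UNIV UNIV "\<lambda>g::'n \<Rightarrow> int. \<Prod>i\<in>UNIV. 1 / (1 + (real_of_int (g i))\<^sup>2)"]
    by simp
  then show ?thesis
  proof (rule summable_on_comparison_test)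
    fix k :: "int ^ 'n"
    have "(1 + (norm (real_vec k))\<^sup>2) powr (- real CARD('n)) = (\<Prod>i\<in>(UNIV::'n set). 1 / (1 + (norm (real_vec k))\<^sup>2))"
      by (simp add: powr_minus powr_realpow divide_simps add_pos_nonneg)
    also have "\<dots> \<le> ?f k"
      by (intro prod_mono conjI frac_le add_mono component_sq_le_norm_real_vec_sq)
         (auto intro: add_pos_nonneg)
    finally show "(1 + (norm (real_vec k))\<^sup>2) powr (- real CARD('n)) \<le> ?f k" .
  qed auto
qed

section \<open>Characters and integrals of periodic functions over the torus\<close>

lemma has_derivative_character:
  "(character k has_derivative
     (\<lambda>v. \<i> * complex_of_real (real_vec k \<bullet> v) * character k x)) (at x)"
proof -
  have "bounded_linear (\<lambda>x. \<i> * complex_of_real (real_vec k \<bullet> x))"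
    by (intro bounded_linear_const_mult bounded_linear_compose[OF bounded_linear_of_real]
        bounded_linear_inner_right)
  from has_derivative_compose[OF bounded_linear_imp_has_derivative[OF this]
      DERIV_exp[unfolded has_field_derivative_def]]
  show ?thesis unfolding character_def by (simp add: mult_ac)
qed

lemma continuous_on_character [continuous_intros]: "continuous_on S (character k)"
  unfolding character_def by (intro continuous_intros)

lemma norm_character [simp]: "norm (character k x) = 1"
  by (simp add: character_def)

lemma real_vec_inner_axis [simp]: "real_vec k \<bullet> axis i 1 = real_of_int (k $ i)"
  by (simp add: inner_axis real_vec_def)

lemma character_mult: "character j x * character k x = character (j + k) x"
proof -
  have "real_vec (j + k) = real_vec j + real_vec k" by (simp add: real_vec_def vec_eq_iff)
  then show ?thesis by (simp add: character_def inner_add_left distrib_left flip: exp_add)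
qed

lemma character_0 [simp]: "character 0 x = 1"
proof -
  have "real_vec 0 = (0 :: real ^ 'a)" by (simp add: real_vec_def vec_eq_iff)
  then show ?thesis by (simp add: character_def)
qed

lemma character_periodic: "character k (x + (2 * pi) *\<^sub>R axis i 1) = character k x"
proof -
  have "character k (x + (2 * pi) *\<^sub>R axis i 1) =
      exp (\<i> * complex_of_real (real_vec k \<bullet> x)) * exp (\<i> * (of_int (k $ i) * (of_real pi * 2)))"
    by (simp add: character_def inner_add_right distrib_left exp_add mult_ac)
  then show ?thesis by (simp add: character_def)
qed

lemma content_torus: "measure lborel (torus :: (real ^ 'n::finite) set) = (2 * pi) ^ CARD('n)"
proof -
  have "cbox 0 (\<chi> i. 2 * pi) \<noteq> ({} :: (real ^ 'n) set)"
    by (simp add: interval_eq_empty_cart not_less)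
  then show ?thesis unfolding torus_def by (subst content_cbox_cart) simp_all
qed

text \<open>The translated box is cut at x_i = 2 pi; the slab that sticks out is moved back by one
  period and fills the gap 0 <= x_i <= s.\<close>

lemma integral_torus_translate:
  fixes F :: "real ^ 'n::finite \<Rightarrow> complex"
  assumes cont: "continuous_on UNIV F"
    and per: "\<And>x. F (x + (2 * pi) *\<^sub>R axis i 1) = F x"
    and s: "0 \<le> s" "s \<le> 2 * pi"
  shows "integral torus (\<lambda>x. F (x + s *\<^sub>R axis i 1)) = integral torus F"
proof -
  let ?e = "axis i (1::real) :: real ^ 'n"
  define T :: "real ^ 'n" where "T = (\<chi> j. 2 * pi)"
  \<comment> \<open>Upper corner of the slab after it has been moved back.\<close>
  define b where "b = (\<chi> j. if j = i then s else 2 * pi)"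
  have i: "F integrable_on cbox u v" for u v
    by (rule integrable_continuous) (rule continuous_on_subset[OF cont], simp)
  have e: "?e \<in> Basis" by simp
  have x_e: "x \<bullet> ?e = x $ i" for x by (simp add: inner_axis)
  have e_j: "?e $ j = (if j = i then 1 else 0)" for j by (simp add: axis_def)
  have mem: "x \<in> cbox u v \<longleftrightarrow> (u $ i \<le> x $ i \<and> x $ i \<le> v $ i) \<and> (\<forall>j. j \<noteq> i \<longrightarrow> u $ j \<le> x $ j \<and> x $ j \<le> v $ j)"
    for u v x :: "real ^ 'n"
    unfolding mem_box_cart by metis
  have "integral torus (\<lambda>x. F (x + s *\<^sub>R ?e)) = integral (cbox (s *\<^sub>R ?e) (T + s *\<^sub>R ?e)) F"
    using integral_shift_cbox_plus[of 0 T F "s *\<^sub>R ?e"] by (simp add: torus_def T_def o_def add.commute)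
  also have "\<dots> = integral (cbox (s *\<^sub>R ?e) (T + s *\<^sub>R ?e) \<inter> {x. x \<bullet> ?e \<le> 2 * pi}) F
      + integral (cbox (s *\<^sub>R ?e) (T + s *\<^sub>R ?e) \<inter> {x. x \<bullet> ?e \<ge> 2 * pi}) F"
    by (rule integral_split[OF i e])
  also have "cbox (s *\<^sub>R ?e) (T + s *\<^sub>R ?e) \<inter> {x. x \<bullet> ?e \<le> 2 * pi} = cbox (s *\<^sub>R ?e) T"
    using s by (auto simp: set_eq_iff mem x_e e_j T_def b_def)
  also have "cbox (s *\<^sub>R ?e) (T + s *\<^sub>R ?e) \<inter> {x. x \<bullet> ?e \<ge> 2 * pi}
      = cbox (0 + (2 * pi) *\<^sub>R ?e) (b + (2 * pi) *\<^sub>R ?e)"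
    using s by (auto simp: set_eq_iff mem x_e e_j T_def b_def)
  also have "integral (cbox (0 + (2 * pi) *\<^sub>R ?e) (b + (2 * pi) *\<^sub>R ?e)) F = integral (cbox 0 b) F"
    using integral_shift_cbox_plus[of 0 b F "(2 * pi) *\<^sub>R ?e"] per by (simp add: o_def add.commute)
  also have "cbox 0 b = cbox 0 T \<inter> {x. x \<bullet> ?e \<le> s}"
    using s by (auto simp: set_eq_iff mem x_e e_j T_def b_def)
  also have "cbox (s *\<^sub>R ?e) T = cbox 0 T \<inter> {x. x \<bullet> ?e \<ge> s}"
    using s by (auto simp: set_eq_iff mem x_e e_j T_def b_def)
  also have "integral (cbox 0 T \<inter> {x. x \<bullet> ?e \<ge> s}) F + integral (cbox 0 T \<inter> {x. x \<bullet> ?e \<le> s}) F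
      = integral (cbox 0 T) F"
    using integral_split[OF i e, of 0 T s] by simp
  finally show ?thesis by (simp add: torus_def T_def)
qed

text \<open>By translation invariance the integral of F(x + s e_i) is constant in s on [0, 2 pi];
  differentiating under the integral sign at s = 0 gives the claim. The derivative at this endpoint
  is one-sided but still unique.\<close>

lemma integral_torus_partial:
  fixes F :: "real ^ 'n::finite \<Rightarrow> complex"
  assumes F: "\<And>x. (F has_derivative F' x) (at x)"
    and cont: "continuous_on UNIV (\<lambda>x. F' x (axis i 1))"
    and per: "\<And>x. F (x + (2 * pi) *\<^sub>R axis i 1) = F x"
  shows "integral torus (\<lambda>x. F' x (axis i 1)) = 0"
proof -
  let ?e = "axis i (1::real) :: real ^ 'n"
  let ?G = "\<lambda>s. integral torus (\<lambda>x. F (x + s *\<^sub>R ?e))"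
  have contF: "continuous_on S F" for S
    using F by (meson continuous_at_imp_continuous_on has_derivative_continuous)
  have d: "((\<lambda>s. F (x + s *\<^sub>R ?e)) has_vector_derivative F' (x + s *\<^sub>R ?e) ?e) (at s within U)" for x s U
  proof -
    have "((\<lambda>s. F (x + s *\<^sub>R ?e)) has_derivative (\<lambda>h. F' (x + s *\<^sub>R ?e) (h *\<^sub>R ?e))) (at s within U)"
      by (rule has_derivative_compose[OF _ F]) (auto intro!: derivative_eq_intros)
    then show ?thesis
      using linear_cmul[OF has_derivative_linear[OF F]] by (simp add: has_vector_derivative_def)
  qed
  have "(?G has_vector_derivative integral torus (\<lambda>x. F' (x + 0 *\<^sub>R ?e) ?e)) (at 0 within cbox 0 (2 * pi))"
    unfolding torus_def
  proof (rule leibniz_rule_vector_derivative)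
    show "(\<lambda>x. F (x + s *\<^sub>R ?e)) integrable_on cbox 0 (\<chi> i. 2 * pi)" for s
      by (intro integrable_continuous continuous_on_compose2[OF contF[of UNIV]] continuous_intros) auto
    show "continuous_on (cbox 0 (2 * pi) \<times> cbox 0 (\<chi> i. 2 * pi))
        (\<lambda>(s, x). F' (x + s *\<^sub>R ?e) ?e)"
      unfolding split_beta by (intro continuous_on_compose2[OF cont] continuous_intros) auto
  qed (use d in auto)
  moreover have "(?G has_vector_derivative 0) (at 0 within cbox 0 (2 * pi))"
  proof (rule has_vector_derivative_transform)
    show "?G s = integral torus F" if "s \<in> cbox 0 (2 * pi)" for s
      using that by (intro integral_torus_translate contF per) auto
  qed auto
  ultimately have "integral torus (\<lambda>x. F' (x + 0 *\<^sub>R ?e) ?e) = 0"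
    by (intro vector_derivative_unique_within_closed_interval[of 0 "2 * pi" 0 ?G]) auto
  then show ?thesis by simp
qed

text \<open>If k_i is nonzero, the character is a multiple of its own i-th partial derivative, whose
  integral vanishes.\<close>

lemma integral_torus_character:
  "integral torus (character (k :: int ^ 'n::finite)) = (if k = 0 then complex_of_real ((2 * pi) ^ CARD('n)) else 0)"
proof (cases "k = 0")
  case True
  have "integral torus (\<lambda>x::real ^ 'n. 1 :: complex) = complex_of_real (measure lborel (torus :: (real ^ 'n) set))"
    unfolding torus_def by (simp add: scaleR_conv_of_real)
  moreover have "character (0 :: int ^ 'n) = (\<lambda>x. 1)" by auto
  ultimately show ?thesis using True by (simp add: content_torus)
next
  case False
  then obtain i where i: "k $ i \<noteq> 0" by (auto simp: vec_eq_iff)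
  have "integral torus (\<lambda>x. \<i> * complex_of_real (real_vec k \<bullet> axis i 1) * character k x) = 0"
    by (rule integral_torus_partial[OF has_derivative_character _ character_periodic])
       (intro continuous_intros)
  then show ?thesis using False i by simp
qed

section \<open>Smooth periodic functions and their C^N norms\<close>

lemma test_function_has_derivative:
  "\<phi> \<in> test_functions \<Longrightarrow> (\<phi> has_derivative frechet_derivative \<phi> (at x)) (at x)"
  unfolding test_functions_def partials_def
  by (auto simp: differentiable_on_def frechet_derivative_works dest!: spec[of _ "[]"])

lemma test_function_partial:
  assumes "\<phi> \<in> test_functions"
  shows "partial i \<phi> \<in> test_functions"
proof -
  \<comment> \<open>\<open>foldr\<close> applies the last list entry first, so the new derivative is
    appended at the end.\<close>
  have "partials js (partial i \<phi>) = partials (js @ [i]) \<phi>" for js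
    by (simp add: partials_def)
  then have "\<forall>js. partials js (partial i \<phi>) differentiable_on UNIV"
    using assms by (simp add: test_functions_def)
  moreover have "partial i \<phi> (x + (2 * pi) *\<^sub>R axis j 1) = partial i \<phi> x" for j x
  proof -
    let ?c = "(2 * pi) *\<^sub>R axis j 1 :: real ^ 'a"
    have "((\<lambda>x. \<phi> (x + ?c)) has_derivative frechet_derivative \<phi> (at (x + ?c))) (at x)"
      by (rule has_derivative_compose[OF _ test_function_has_derivative[OF assms]])
         (auto intro!: derivative_eq_intros)
    moreover have "(\<lambda>x. \<phi> (x + ?c)) = \<phi>"
      using assms by (auto simp: test_functions_def)
    ultimately show ?thesis
      unfolding partial_def using frechet_derivative_at by metis
  qed
  ultimately show ?thesis by (simp add: test_functions_def)
qed

lemma test_function_partials: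
  "\<phi> \<in> test_functions \<Longrightarrow> partials js \<phi> \<in> test_functions"
  unfolding partials_def by (induction js) (auto intro: test_function_partial)

lemma test_function_continuous:
  assumes "\<phi> \<in> test_functions"
  shows "continuous_on S \<phi>"
  using test_function_has_derivative[OF assms]
  by (meson continuous_at_imp_continuous_on has_derivative_continuous)

text \<open>Reduces suprema over the whole space to a compact set: coordinate i is moved back by
  floor (x_i / (2 pi)) periods.\<close>

lemma test_function_value_on_torus:
  fixes \<phi> :: "real ^ 'n::finite \<Rightarrow> complex"
  assumes "\<phi> \<in> test_functions"
  shows "\<exists>y\<in>torus. \<phi> x = \<phi> y"
proof -
  have per: "\<phi> (x + (2 * pi) *\<^sub>R axis i 1) = \<phi> x" for x i
    using assms by (auto simp: test_functions_def)
  have nat: "\<phi> (x + (2 * pi * real n) *\<^sub>R axis i 1) = \<phi> x" for n x i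
  proof (induction n)
    case (Suc n)
    have "x + (2 * pi * real (Suc n)) *\<^sub>R axis i 1 =
        (x + (2 * pi * real n) *\<^sub>R axis i 1) + (2 * pi) *\<^sub>R axis i 1"
      by (simp add: algebra_simps)
    then show ?case using per Suc by metis
  qed simp
  have int: "\<phi> (x + (2 * pi * real_of_int m) *\<^sub>R axis i 1) = \<phi> x" for m x i
  proof (cases m rule: int_cases2)
    case (nonneg n)
    then show ?thesis using nat by simp
  next
    case (nonpos n)
    then show ?thesis
      using nat[of "x + (2 * pi * real_of_int m) *\<^sub>R axis i 1" n i] by simp
  qed
  have sum: "\<phi> (x + (\<Sum>i\<in>A. (2 * pi * real_of_int (m i)) *\<^sub>R axis i 1)) = \<phi> x" if "finite A" for A m
    using that
  proof (induction A)
    case (insert i A)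
    then show ?case
      using int[of "x + (\<Sum>i\<in>A. (2 * pi * real_of_int (m i)) *\<^sub>R axis i 1)" "m i" i]
      by (simp add: add_ac)
  qed simp
  define y where "y = x + (\<Sum>i\<in>UNIV. (2 * pi * real_of_int (- \<lfloor>x $ i / (2 * pi)\<rfloor>)) *\<^sub>R axis i 1)"
  have "y $ j = x $ j - 2 * pi * real_of_int \<lfloor>x $ j / (2 * pi)\<rfloor>" for j
  proof -
    have "(\<Sum>i\<in>UNIV. (2 * pi * real_of_int (- \<lfloor>x $ i / (2 * pi)\<rfloor>)) *\<^sub>R axis i (1::real)) $ j =
        (\<Sum>i\<in>UNIV. if i = j then 2 * pi * real_of_int (- \<lfloor>x $ i / (2 * pi)\<rfloor>) else 0)"
      unfolding sum_component by (intro sum.cong) (auto simp: axis_def)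
    then show ?thesis by (simp add: y_def)
  qed
  moreover have "0 \<le> t - 2 * pi * real_of_int \<lfloor>t / (2 * pi)\<rfloor>"
    "t - 2 * pi * real_of_int \<lfloor>t / (2 * pi)\<rfloor> \<le> 2 * pi" for t :: real
  proof -
    have "real_of_int \<lfloor>t / (2 * pi)\<rfloor> \<le> t / (2 * pi)" "t / (2 * pi) \<le> real_of_int \<lfloor>t / (2 * pi)\<rfloor> + 1"
      by linarith+
    from mult_left_mono[OF this(1), of "2 * pi"] mult_left_mono[OF this(2), of "2 * pi"]
    show "0 \<le> t - 2 * pi * real_of_int \<lfloor>t / (2 * pi)\<rfloor>"
      "t - 2 * pi * real_of_int \<lfloor>t / (2 * pi)\<rfloor> \<le> 2 * pi"
      by (simp_all only: distrib_left) simp_all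
  qed
  ultimately have "y \<in> torus"
    by (simp add: torus_def mem_box_cart)
  moreover have "\<phi> x = \<phi> y" unfolding y_def by (rule sum[symmetric]) simp
  ultimately show ?thesis by blast
qed

text \<open>A real supremum bounds its members only if the set is bounded above. Here there are
  finitely many derivative lists of length at most N, and each derivative is continuous and
  periodic, hence bounded.\<close>

lemma norm_partials_le_C_norm:
  fixes \<phi> :: "real ^ 'n::finite \<Rightarrow> complex"
  assumes \<phi>: "\<phi> \<in> test_functions" and len: "length js \<le> N"
  shows "norm (partials js \<phi> x) \<le> C_norm N \<phi>"
proof -
  have bd: "\<exists>B. \<forall>x. norm (partials js \<phi> x) \<le> B" for js
  proof -
    have t: "partials js \<phi> \<in> test_functions" using \<phi> by (rule test_function_partials)
    have "compact (partials js \<phi> ` torus)"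
      unfolding torus_def by (intro compact_continuous_image test_function_continuous t compact_cbox)
    then obtain B where "\<forall>y\<in>torus. norm (partials js \<phi> y) \<le> B"
      using compact_imp_bounded by (fastforce simp: bounded_iff)
    then show ?thesis using test_function_value_on_torus[OF t] by metis
  qed
  then obtain B where B: "\<And>js x. norm (partials js \<phi> x) \<le> B js" by metis
  let ?L = "{js :: 'n list. length js \<le> N}"
  have "finite ?L" using finite_lists_length_le[of "UNIV :: 'n set" N] by simp
  then have "B js \<le> Max (B ` ?L)" if "length js \<le> N" for js using that by simp
  then have "bdd_above ((\<lambda>(js, x). norm (partials js \<phi> x)) ` (?L \<times> UNIV))"
    using B order_trans by (intro bdd_aboveI[of _ "Max (B ` ?L)"]) fast
  then show ?thesis
    unfolding C_norm_def using len by (intro cSUP_upper2[of _ _ "(js, x)"]) auto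
qed

section \<open>Rapid decay of the pairings with characters\<close>

lemma integrable_character_mult:
  "\<phi> \<in> test_functions \<Longrightarrow> (\<lambda>x. character k x * \<phi> x) integrable_on torus"
  unfolding torus_def
  by (intro integrable_continuous continuous_intros test_function_continuous)

lemma norm_pairing_le:
  fixes \<phi> :: "real ^ 'n::finite \<Rightarrow> complex"
  assumes \<phi>: "\<phi> \<in> test_functions" and B: "\<And>x. norm (\<phi> x) \<le> B"
  shows "norm (function_distribution (character k) \<phi>) \<le> (2 * pi) ^ CARD('n) * B"
proof -
  have "0 \<le> B" using B norm_ge_zero order_trans by blast
  then have "norm (integral torus (\<lambda>x. character k x * \<phi> x)) \<le> B * measure lborel (torus :: (real ^ 'n) set)"
    using integrable_integral[OF integrable_character_mult[OF \<phi>, of k]] B unfolding torus_def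
    by (intro has_integral_bound) (auto simp: norm_mult)
  then show ?thesis by (simp add: function_distribution_def content_torus mult.commute)
qed

text \<open>Integration by parts without boundary terms: the product of character and test function
  is periodic, so its partial derivative integrates to 0.\<close>

lemma pairing_partial:
  assumes \<phi>: "\<phi> \<in> test_functions"
  shows "function_distribution (character k) (partial i \<phi>) =
    - (\<i> * of_int (k $ i) * function_distribution (character k) \<phi>)"
proof -
  define F' where "F' = (\<lambda>x v. character k x * frechet_derivative \<phi> (at x) v
      + \<i> * complex_of_real (real_vec k \<bullet> v) * character k x * \<phi> x)"
  have F'_i: "F' x (axis i 1) = character k x * partial i \<phi> x
      + \<i> * of_int (k $ i) * (character k x * \<phi> x)" for x
    by (simp add: F'_def partial_def)
  have \<phi>': "partial i \<phi> \<in> test_functions" using \<phi> by (rule test_function_partial)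
  have "integral torus (\<lambda>x. F' x (axis i 1)) = 0"
  proof (rule integral_torus_partial)
    show "((\<lambda>x. character k x * \<phi> x) has_derivative F' x) (at x)" for x
      unfolding F'_def
      by (rule has_derivative_mult[OF has_derivative_character test_function_has_derivative[OF \<phi>]])
    show "continuous_on UNIV (\<lambda>x. F' x (axis i 1))"
      unfolding F'_i by (intro continuous_intros test_function_continuous \<phi> \<phi>')
    show "character k (x + (2 * pi) *\<^sub>R axis i 1) * \<phi> (x + (2 * pi) *\<^sub>R axis i 1) =
        character k x * \<phi> x" for x
      using \<phi> by (simp add: character_periodic test_functions_def)
  qed
  moreover have "integral torus (\<lambda>x. F' x (axis i 1)) =
      function_distribution (character k) (partial i \<phi>) +
      \<i> * of_int (k $ i) * function_distribution (character k) \<phi>"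
    unfolding F'_i function_distribution_def
    by (subst integral_add)
       (use integrable_character_mult[OF \<phi>] integrable_character_mult[OF \<phi>'] in
         \<open>auto intro: integrable_on_mult_right\<close>)
  ultimately show ?thesis by (simp add: eq_neg_iff_add_eq_0)
qed

lemma pairing_decay_component:
  fixes \<phi> :: "real ^ 'n::finite \<Rightarrow> complex"
  assumes \<phi>: "\<phi> \<in> test_functions" and "r \<le> N"
  shows "\<bar>real_of_int (k $ i)\<bar> ^ r * norm (function_distribution (character k) \<phi>)
    \<le> (2 * pi) ^ CARD('n) * C_norm N \<phi>"
proof -
  have "norm (function_distribution (character k) (partials (replicate r i) \<phi>)) =
      \<bar>real_of_int (k $ i)\<bar> ^ r * norm (function_distribution (character k) \<phi>)"
  proof (induction r)
    case (Suc r)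
    have "partials (replicate (Suc r) i) \<phi> = partial i (partials (replicate r i) \<phi>)"
      by (simp add: partials_def)
    then show ?case
      using Suc by (simp add: pairing_partial test_function_partials[OF \<phi>] norm_mult)
  qed (simp add: partials_def)
  then show ?thesis
    using norm_pairing_le[OF test_function_partials[OF \<phi>] norm_partials_le_C_norm[OF \<phi>],
        of "replicate r i" N k] \<open>r \<le> N\<close> by simp
qed

text \<open>All 2 M derivatives are spent in the direction of a largest coordinate of k. For nonzero
  k it satisfies k_i^2 >= 1 and n k_i^2 >= |k|^2, which gives the constant 1 + n.\<close>

lemma pairing_decay:
  fixes \<phi> :: "real ^ 'n::finite \<Rightarrow> complex"
  assumes \<phi>: "\<phi> \<in> test_functions"
  shows "(1 + (norm (real_vec k))\<^sup>2) ^ M * norm (function_distribution (character k) \<phi>)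
    \<le> (1 + real CARD('n)) ^ M * (2 * pi) ^ CARD('n) * C_norm (2 * M) \<phi>"
proof -
  define I where "I = norm (function_distribution (character k) \<phi>)"
  \<comment> \<open>The exponent is r = 0 for k = 0, where the weight is 1 and every coordinate
    vanishes, and r = 2 M otherwise.\<close>
  have "\<exists>i r. r \<le> 2 * M \<and> (1 + (norm (real_vec k))\<^sup>2) ^ M \<le> (1 + real CARD('n)) ^ M * \<bar>real_of_int (k $ i)\<bar> ^ r"
  proof (cases "k = 0")
    case True
    then show ?thesis by (intro exI[of _ _] exI[of _ 0]) (simp add: norm_real_vec_sq)
  next
    case False
    obtain i where i: "\<And>j. \<bar>k $ j\<bar> \<le> \<bar>k $ i\<bar>"
    proof -
      have "Max (range (\<lambda>j. \<bar>k $ j\<bar>)) \<in> range (\<lambda>j. \<bar>k $ j\<bar>)" by (intro Max_in) auto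
      then obtain i where "Max (range (\<lambda>j. \<bar>k $ j\<bar>)) = \<bar>k $ i\<bar>" by blast
      then show ?thesis using that Max_ge[of "range (\<lambda>j. \<bar>k $ j\<bar>)"] by fastforce
    qed
    have "k $ i \<noteq> 0"
    proof
      assume "k $ i = 0"
      then have "k = 0" using i by (auto simp: vec_eq_iff)
      with False show False ..
    qed
    then have "1 \<le> \<bar>real_of_int (k $ i)\<bar>" by linarith
    then have "1 \<le> (real_of_int (k $ i))\<^sup>2" using one_le_power[of "\<bar>real_of_int (k $ i)\<bar>" 2] by simp
    moreover have "(norm (real_vec k))\<^sup>2 \<le> real CARD('n) * (real_of_int (k $ i))\<^sup>2"
      unfolding norm_real_vec_sq
    proof (rule sum_bounded_above)
      fix j show "(real_of_int (k $ j))\<^sup>2 \<le> (real_of_int (k $ i))\<^sup>2"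
        using i[of j] by (simp add: abs_le_square_iff[symmetric])
    qed
    ultimately have "1 + (norm (real_vec k))\<^sup>2 \<le> (1 + real CARD('n)) * (real_of_int (k $ i))\<^sup>2"
      by (simp add: distrib_right)
    then have "(1 + (norm (real_vec k))\<^sup>2) ^ M \<le> ((1 + real CARD('n)) * (real_of_int (k $ i))\<^sup>2) ^ M"
      by (intro power_mono) auto
    then show ?thesis
      by (intro exI[of _ i] exI[of _ "2 * M"]) (simp add: power_mult_distrib power_mult)
  qed
  then obtain i r where r: "r \<le> 2 * M"
    and "(1 + (norm (real_vec k))\<^sup>2) ^ M \<le> (1 + real CARD('n)) ^ M * \<bar>real_of_int (k $ i)\<bar> ^ r" by blast
  then have "(1 + (norm (real_vec k))\<^sup>2) ^ M * I \<le> (1 + real CARD('n)) ^ M * \<bar>real_of_int (k $ i)\<bar> ^ r * I"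
    by (intro mult_right_mono) (auto simp: I_def)
  also have "\<dots> = (1 + real CARD('n)) ^ M * (\<bar>real_of_int (k $ i)\<bar> ^ r * I)" by simp
  also have "\<dots> \<le> (1 + real CARD('n)) ^ M * ((2 * pi) ^ CARD('n) * C_norm (2 * M) \<phi>)"
    unfolding I_def by (intro mult_left_mono pairing_decay_component \<phi> r) auto
  finally show ?thesis by (simp add: I_def mult_ac)
qed

subsection \<open>Trigonometric series in Sobolev spaces\<close>

abbreviation weight :: "int ^ 'n::finite \<Rightarrow> real" where
  "weight k \<equiv> 1 + (norm (real_vec k))\<^sup>2"

definition weighted_l2 :: "real \<Rightarrow> (int ^ 'n::finite \<Rightarrow> complex) \<Rightarrow> bool" where
  "weighted_l2 q c \<longleftrightarrow> (\<lambda>k. weight k powr q * (norm (c k))\<^sup>2) summable_on UNIV"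

lemma weight_gt_0: "0 < weight k"
  by (simp add: add_pos_nonneg)

lemma weighted_l2_comparison:
  assumes "weighted_l2 r c"
    and "\<And>k. weight k powr q * (norm (d k))\<^sup>2 \<le> A * (weight k powr r * (norm (c k))\<^sup>2)"
  shows "weighted_l2 q d"
  unfolding weighted_l2_def
proof (rule summable_on_comparison_test)
  show "(\<lambda>k. A * (weight k powr r * (norm (c k))\<^sup>2)) summable_on UNIV"
    using assms(1) unfolding weighted_l2_def by (rule summable_on_cmult_right)
qed (use assms(2) in auto)

text \<open>Each term of a convergent nonnegative sum is at most the total T, so K = sqrt T
  works.\<close>

lemma weighted_l2_imp_polynomial_growth:
  fixes c :: "int ^ 'n::finite \<Rightarrow> complex"
  assumes "weighted_l2 q c"
  obtains K where "K \<ge> 0" "\<And>k. norm (c k) \<le> K * weight k powr (- q / 2)"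
proof
  let ?f = "\<lambda>k. weight k powr q * (norm (c k))\<^sup>2"
  define T where "T = infsum ?f UNIV"
  have T: "?f k \<le> T" for k
    unfolding T_def using finite_sum_le_infsum[of ?f UNIV "{k}"] assms
    by (simp add: weighted_l2_def)
  have "0 \<le> T" using T[of 0] by (rule order_trans[rotated]) simp
  then show "sqrt T \<ge> 0" by simp
  fix k :: "int ^ 'n"
  have inv: "weight k powr (- q) * weight k powr q = 1"
    unfolding powr_add[symmetric] using weight_gt_0[of k] by simp
  have half: "(weight k powr (- q / 2))\<^sup>2 = weight k powr (- q)"
    unfolding power2_eq_square[of "weight k powr _"] powr_add[symmetric] by (rule arg_cong[where f = "(powr) (weight k)"]) simp
  have "(norm (c k))\<^sup>2 = weight k powr (- q) * ?f k"
    unfolding mult.assoc[symmetric] inv by simp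
  also have "\<dots> \<le> weight k powr (- q) * T" by (rule mult_left_mono[OF T]) simp
  also have "\<dots> = (sqrt T * weight k powr (- q / 2))\<^sup>2"
    unfolding power_mult_distrib half real_sqrt_pow2[OF \<open>0 \<le> T\<close>] by (rule mult.commute)
  finally show "norm (c k) \<le> sqrt T * weight k powr (- q / 2)"
    by (rule power2_le_imp_le) (simp add: \<open>0 \<le> T\<close>)
qed

text \<open>Coefficients of polynomial growth meet pairings that decay faster than any power, so the
  series converges absolutely and is controlled by a single C^N norm.\<close>

lemma trig_series_continuous:
  fixes c :: "int ^ 'n::finite \<Rightarrow> complex"
  assumes "weighted_l2 q c"
  shows "\<exists>N C. \<forall>\<phi>\<in>test_functions.
    (\<lambda>k. c k * function_distribution (character k) \<phi>) summable_on UNIV \<and>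
    norm (trig_series c \<phi>) \<le> C * C_norm N \<phi>"
proof -
  obtain K where K: "K \<ge> 0" "\<And>k. norm (c k) \<le> K * weight k powr (- q / 2)"
    using weighted_l2_imp_polynomial_growth[OF assms] by blast
  \<comment> \<open>The decay weight^(-M) has to offset the growth weight^(-q/2) and leave
    weight^(-n), which is summable over the lattice.\<close>
  obtain M :: nat where M: "real CARD('n) + \<bar>q\<bar> / 2 \<le> real M" using real_arch_simple by blast
  define D where "D = (1 + real CARD('n)) ^ M * (2 * pi) ^ CARD('n)"
  define Z where "Z = (\<Sum>\<^sub>\<infinity>k::int ^ 'n. weight k powr (- real CARD('n)))"
  have bound: "norm (c k * function_distribution (character k) \<phi>)
      \<le> K * (D * C_norm (2 * M) \<phi>) * weight k powr (- real CARD('n))"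
    if \<phi>: "\<phi> \<in> test_functions" for \<phi> k
  proof -
    let ?I = "norm (function_distribution (character k) \<phi>)"
    have "weight k powr (- q / 2) \<le> weight k powr (- real CARD('n)) * weight k ^ M"
    proof -
      have "weight k powr (- q / 2) \<le> weight k powr (- real CARD('n) + real M)"
        using M by (intro powr_mono) (auto simp: abs_if split: if_splits)
      then show ?thesis unfolding powr_add powr_realpow[OF weight_gt_0] .
    qed
    have "norm (c k * function_distribution (character k) \<phi>) \<le> K * weight k powr (- q / 2) * ?I"
      unfolding norm_mult by (rule mult_right_mono[OF K(2)]) simp
    also have "\<dots> \<le> K * (weight k powr (- real CARD('n)) * weight k ^ M) * ?I"
      by (intro mult_right_mono mult_left_mono K(1)) (fact, simp)
    also have "\<dots> = K * weight k powr (- real CARD('n)) * (weight k ^ M * ?I)" by simp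
    also have "\<dots> \<le> K * weight k powr (- real CARD('n)) * (D * C_norm (2 * M) \<phi>)"
      unfolding D_def using K by (intro mult_left_mono pairing_decay \<phi>) auto
    finally show ?thesis by (simp add: mult_ac)
  qed
  have dom: "(\<lambda>k::int ^ 'n. A * weight k powr (- real CARD('n))) summable_on UNIV" for A
    by (intro summable_on_cmult_right summable_on_lattice)
  have abs: "(\<lambda>k. norm (c k * function_distribution (character k) \<phi>)) summable_on UNIV"
    if "\<phi> \<in> test_functions" for \<phi>
    by (rule summable_on_comparison_test[OF dom bound[OF that]]) auto
  show ?thesis
  proof (intro exI ballI conjI)
    fix \<phi> :: "real ^ 'n \<Rightarrow> complex" assume \<phi>: "\<phi> \<in> test_functions"
    show "(\<lambda>k. c k * function_distribution (character k) \<phi>) summable_on UNIV"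
      by (rule abs_summable_summable) (rule abs[OF \<phi>])
    have "norm (trig_series c \<phi>) \<le> (\<Sum>\<^sub>\<infinity>k. norm (c k * function_distribution (character k) \<phi>))"
      unfolding trig_series_def by (rule norm_infsum_bound) (rule abs[OF \<phi>])
    also have "\<dots> \<le> (\<Sum>\<^sub>\<infinity>k::int ^ 'n. K * (D * C_norm (2 * M) \<phi>) * weight k powr (- real CARD('n)))"
      by (intro infsum_mono abs dom bound \<phi>)
    also have "\<dots> = K * (D * C_norm (2 * M) \<phi>) * Z"
      unfolding Z_def by (rule infsum_cmult_right')
    finally show "norm (trig_series c \<phi>) \<le> K * D * Z * C_norm (2 * M) \<phi>" by (simp add: mult_ac)
  qed
qed

lemma periodic_distribution_trig_series:
  assumes "weighted_l2 q c"
  shows "periodic_distribution (trig_series c)"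
proof -
  obtain N C where cont: "\<forall>\<phi>\<in>test_functions.
      (\<lambda>k. c k * function_distribution (character k) \<phi>) summable_on UNIV \<and>
      norm (trig_series c \<phi>) \<le> C * C_norm N \<phi>"
    using trig_series_continuous[OF assms] by (elim exE)
  note sm = cont[THEN bspec, THEN conjunct1]
  \<comment> \<open>Additivity uses the summability of both parts, since \<open>infsum\<close> takes
    the default value 0 on families that are not summable.\<close>
  have "trig_series c (\<lambda>x. \<phi> x + \<psi> x) = trig_series c \<phi> + trig_series c \<psi>"
    if "\<phi> \<in> test_functions" "\<psi> \<in> test_functions" for \<phi> \<psi>
  proof -
    have "function_distribution (character k) (\<lambda>x. \<phi> x + \<psi> x) =
        function_distribution (character k) \<phi> + function_distribution (character k) \<psi>" for k
      unfolding function_distribution_def distrib_left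
      by (intro integral_add integrable_character_mult that)
    then show ?thesis
      unfolding trig_series_def by (simp only: distrib_left infsum_add[OF sm[OF that(1)] sm[OF that(2)]])
  qed
  moreover have "trig_series c (\<lambda>x. a * \<phi> x) = a * trig_series c \<phi>" for a \<phi>
  proof -
    have "function_distribution (character k) (\<lambda>x. a * \<phi> x) =
        a * function_distribution (character k) \<phi>" for k
      unfolding function_distribution_def mult.left_commute[of _ a] by (rule integral_mult_right)
    then show ?thesis
      unfolding trig_series_def by (simp only: mult.left_commute[of _ a] infsum_cmult_right')
  qed
  moreover have "\<exists>N C. \<forall>\<phi>\<in>test_functions. norm (trig_series c \<phi>) \<le> C * C_norm N \<phi>"
    by (rule exI[of _ N], rule exI[of _ C]) (use cont in simp)
  ultimately show ?thesis
    unfolding periodic_distribution_def by (intro conjI ballI allI)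
qed

text \<open>Pairing with one character leaves a single nonzero term by orthogonality, so the
  infinite sum collapses to a finite one.\<close>

lemma fourier_coeff_trig_series:
  fixes c :: "int ^ 'n::finite \<Rightarrow> complex"
  shows "fourier_coeff (trig_series c) k = c k"
proof -
  define V where "V = complex_of_real ((2 * pi) ^ CARD('n))"
  have "V \<noteq> 0" by (simp add: V_def)
  have "function_distribution (character j) (character (- k)) = (if j = k then V else 0)" for j
    unfolding function_distribution_def character_mult V_def
    by (simp only: integral_torus_character add_eq_0_iff2 minus_minus)
  then have "trig_series c (character (- k)) = (\<Sum>\<^sub>\<infinity>j. c j * (if j = k then V else 0))"
    by (simp only: trig_series_def)
  also have "\<dots> = (\<Sum>\<^sub>\<infinity>j\<in>{k}. c j * V)"
    by (rule infsum_cong_neutral) auto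
  also have "\<dots> = c k * V" by (subst infsum_finite) simp_all
  finally show ?thesis
    unfolding fourier_coeff_def V_def[symmetric] using \<open>V \<noteq> 0\<close> by simp
qed

lemma trig_series_in_sobolev:
  assumes "weighted_l2 q c"
  shows "trig_series c \<in> sobolev q"
  using periodic_distribution_trig_series[OF assms] assms
  unfolding sobolev_def weighted_l2_def mem_Collect_eq fourier_coeff_trig_series ..

section \<open>Differentiating trigonometric series in the time variable\<close>

lemma infsum_tendsto_0_dominated:
  fixes f :: "'a \<Rightarrow> 'b \<Rightarrow> real"
  assumes lim: "\<And>k. ((\<lambda>x. f x k) \<longlongrightarrow> 0) F"
    and dom: "eventually (\<lambda>x. \<forall>k. \<bar>f x k\<bar> \<le> g k) F"
    and sm: "g summable_on UNIV"
  shows "((\<lambda>x. infsum (f x) UNIV) \<longlongrightarrow> 0) F"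
\<comment> \<open>By the Weierstrass M-test the finite partial sums converge uniformly in x, so the
  limit along F may be exchanged with the limit over finite sets.\<close>
proof (rule swap_uniform_limit')
  show "\<forall>\<^sub>F A in finite_subsets_at_top UNIV. ((\<lambda>x. \<Sum>k\<in>A. f x k) \<longlongrightarrow> 0) F"
    by (intro always_eventually allI tendsto_null_sum lim)
  show "((\<lambda>A. 0) \<longlongrightarrow> 0) (finite_subsets_at_top UNIV)" by (rule tendsto_const)
  show "uniform_limit {x. \<forall>k. \<bar>f x k\<bar> \<le> g k} (\<lambda>A x. \<Sum>k\<in>A. f x k) (\<lambda>x. infsum (f x) UNIV)
      (finite_subsets_at_top UNIV)"
    by (rule Weierstrass_m_test_general[OF _ sm]) auto
  show "\<forall>\<^sub>F x in F. x \<in> {x. \<forall>k. \<bar>f x k\<bar> \<le> g k}" using dom by simp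
qed simp

text \<open>By the mean value theorem on [t-1, t+1], d bounds every difference quotient with |h| <=
  1 and thus supplies the dominating sequence.\<close>

lemma has_sobolev_derivative_trig_series:
  fixes c :: "int ^ 'n::finite \<Rightarrow> complex" and u u' :: "real \<Rightarrow> int ^ 'n \<Rightarrow> real"
  assumes der: "\<And>k s. ((\<lambda>s. u s k) has_real_derivative u' s k) (at s)"
    and bd: "\<And>k s. \<bar>s - t\<bar> \<le> 1 \<Longrightarrow> \<bar>u' s k\<bar> \<le> d k"
    and sm: "weighted_l2 q (\<lambda>k. c k * complex_of_real (d k))"
  shows "has_sobolev_derivative q (\<lambda>s. trig_series (\<lambda>k. c k * complex_of_real (u s k)))
           (trig_series (\<lambda>k. c k * complex_of_real (u' t k))) t"
proof -
  define r where "r = (\<lambda>h k. (u (t + h) k - u t k) / h - u' t k)"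
  define f where "f = (\<lambda>h k. weight k powr q * (norm (c k) * \<bar>r h k\<bar>)\<^sup>2)"
  let ?F = "at 0 within {h. 0 \<le> t + h}"
  \<comment> \<open>A Fourier coefficient is the value of the functional at one character, so
    pointwise linear combinations of functionals pass directly to coefficients.\<close>
  have norm_eq: "sobolev_norm q (\<lambda>\<phi>. (trig_series (\<lambda>k. c k * complex_of_real (u (t + h) k)) \<phi> -
        trig_series (\<lambda>k. c k * complex_of_real (u t k)) \<phi>) / complex_of_real h -
        trig_series (\<lambda>k. c k * complex_of_real (u' t k)) \<phi>) = sqrt (infsum (f h) UNIV)" for h
  proof -
    have "fourier_coeff (\<lambda>\<phi>. (T \<phi> - S \<phi>) / complex_of_real h - D \<phi>) k =
        (fourier_coeff T k - fourier_coeff S k) / complex_of_real h - fourier_coeff D k"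
      for T S D :: "'n functional" and k
      by (simp add: fourier_coeff_def diff_divide_distrib mult.commute)
    moreover have "(c k * complex_of_real (u (t + h) k) - c k * complex_of_real (u t k)) / complex_of_real h -
        c k * complex_of_real (u' t k) = c k * complex_of_real (r h k)" for k
      by (simp add: r_def diff_divide_distrib right_diff_distrib)
    ultimately show ?thesis
      by (simp add: sobolev_norm_def fourier_coeff_trig_series f_def norm_mult)
  qed
  have "((\<lambda>h. infsum (f h) UNIV) \<longlongrightarrow> 0) ?F"
  proof (rule infsum_tendsto_0_dominated)
    fix k
    have "((\<lambda>h. (u (t + h) k - u t k) / h) \<longlongrightarrow> u' t k) (at 0)"
      using der[of k t] by (simp add: DERIV_def)
    then have "((\<lambda>h. (u (t + h) k - u t k) / h) \<longlongrightarrow> u' t k) ?F"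
      by (rule tendsto_within_subset) simp
    then have "((\<lambda>h. r h k) \<longlongrightarrow> 0) ?F"
      unfolding r_def by (simp add: LIM_zero_iff)
    then have "((\<lambda>h. f h k) \<longlongrightarrow> weight k powr q * (norm (c k) * \<bar>0\<bar>)\<^sup>2) ?F"
      unfolding f_def by (intro tendsto_intros)
    then show "((\<lambda>h. f h k) \<longlongrightarrow> 0) ?F" by simp
  next
    have "\<forall>\<^sub>F h in ?F. h \<noteq> 0 \<and> \<bar>h\<bar> \<le> 1"
      unfolding eventually_at by (intro exI[of _ 1]) auto
    then show "\<forall>\<^sub>F h in ?F. \<forall>k. \<bar>f h k\<bar> \<le> 4 * (weight k powr q * (norm (c k * complex_of_real (d k)))\<^sup>2)"
    proof eventually_elim
      case (elim h)
      show ?case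
      proof
        fix k
        have "d k \<ge> 0" using bd[of t k] by simp
        have "\<bar>u (t + h) k - u t k\<bar> \<le> d k * \<bar>h\<bar>"
        proof -
          have "norm (u (t + h) k - u t k) \<le> d k * norm (t + h - t)"
          proof (rule field_differentiable_bound[of "cball t 1"])
            show "((\<lambda>s. u s k) has_real_derivative u' s k) (at s within cball t 1)" for s
              by (rule has_field_derivative_at_within) (rule der)
            show "norm (u' s k) \<le> d k" if "s \<in> cball t 1" for s
              using bd[of s k] that by (simp add: dist_real_def abs_minus_commute)
          qed (use elim in \<open>auto simp: dist_real_def\<close>)
          then show ?thesis by simp
        qed
        then have "\<bar>(u (t + h) k - u t k) / h\<bar> \<le> d k"
          using elim by (simp add: field_simps)
        moreover have "\<bar>u' t k\<bar> \<le> d k" using bd[of t k] by simp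
        \<comment> \<open>Quotient and derivative are each at most d; squaring the factor 2 gives
          the 4 in the dominating sequence.\<close>
        ultimately have "\<bar>r h k\<bar> \<le> 2 * d k" unfolding r_def by linarith
        then have "(norm (c k) * \<bar>r h k\<bar>)\<^sup>2 \<le> (norm (c k) * (2 * d k))\<^sup>2"
          by (intro power_mono mult_left_mono) auto
        then have "weight k powr q * (norm (c k) * \<bar>r h k\<bar>)\<^sup>2 \<le> weight k powr q * (norm (c k) * (2 * d k))\<^sup>2"
          by (intro mult_left_mono) auto
        also have "\<dots> = 4 * (weight k powr q * (norm (c k * complex_of_real (d k)))\<^sup>2)"
          using \<open>d k \<ge> 0\<close> by (simp add: norm_mult power_mult_distrib)
        finally show "\<bar>f h k\<bar> \<le> 4 * (weight k powr q * (norm (c k * complex_of_real (d k)))\<^sup>2)"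
          by (simp add: f_def)
      qed
    qed
    show "(\<lambda>k. 4 * (weight k powr q * (norm (c k * complex_of_real (d k)))\<^sup>2)) summable_on UNIV"
      using sm unfolding weighted_l2_def by (rule summable_on_cmult_right)
  qed
  from tendsto_real_sqrt[OF this] show ?thesis
    unfolding has_sobolev_derivative_def norm_eq by simp
qed

text \<open>\<open>u j\<close> plays the role of the j-th time derivative of \<open>u 0\<close>. The
  bound separates time from frequency, so one weighted l^2 condition on d serves all orders and all
  times.\<close>

lemma C_sobolev_trig_series:
  fixes c :: "int ^ 'n::finite \<Rightarrow> complex" and u :: "nat \<Rightarrow> real \<Rightarrow> int ^ 'n \<Rightarrow> real"
  assumes "\<And>j k s. j < P \<Longrightarrow> ((\<lambda>s. u j s k) has_real_derivative u (Suc j) s k) (at s)"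
    and "\<And>j k s. j \<le> P \<Longrightarrow> \<bar>u j s k\<bar> \<le> (1 + \<bar>s\<bar> + s\<^sup>2) * d k"
    and sm: "weighted_l2 q (\<lambda>k. c k * complex_of_real (d k))"
  shows "C_sobolev P q (\<lambda>s. trig_series (\<lambda>k. c k * complex_of_real (u 0 s k)))"
  using assms(1,2)
proof (induction P arbitrary: u)
  have sob: "trig_series (\<lambda>k. c k * complex_of_real (v k)) \<in> sobolev q"
    if "\<And>k. \<bar>v k\<bar> \<le> A * d k" for v A
  proof (intro trig_series_in_sobolev weighted_l2_comparison[OF sm])
    fix k
    have "(norm (c k) * \<bar>v k\<bar>)\<^sup>2 \<le> (norm (c k) * (A * d k))\<^sup>2"
      by (intro power_mono mult_left_mono that) auto
    then have "weight k powr q * (norm (c k) * \<bar>v k\<bar>)\<^sup>2 \<le> weight k powr q * (norm (c k) * (A * d k))\<^sup>2"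
      by (intro mult_left_mono) auto
    then show "weight k powr q * (norm (c k * complex_of_real (v k)))\<^sup>2
        \<le> A\<^sup>2 * (weight k powr q * (norm (c k * complex_of_real (d k)))\<^sup>2)"
      by (simp add: norm_mult power_mult_distrib mult_ac)
  qed
  {
    case 0
    then show ?case using sob[of "u 0 t" "1 + \<bar>t\<bar> + t\<^sup>2" for t] by simp
  next
    case (Suc P)
    have "has_sobolev_derivative q (\<lambda>s. trig_series (\<lambda>k. c k * complex_of_real (u 0 s k)))
        (trig_series (\<lambda>k. c k * complex_of_real (u 1 t k))) t" for t
    proof -
      \<comment> \<open>Bounds 1 + |s| + s^2 for all s within distance 1 of t, as domination
        requires.\<close>
      define A where "A = 1 + (\<bar>t\<bar> + 1) + (\<bar>t\<bar> + 1)\<^sup>2"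
      show ?thesis
      proof (rule has_sobolev_derivative_trig_series[where d = "\<lambda>k. A * d k"])
        show "((\<lambda>s. u 0 s k) has_real_derivative u 1 s k) (at s)" for k s
          using Suc.prems(1)[of 0] by simp
        show "\<bar>u 1 s k\<bar> \<le> A * d k" if "\<bar>s - t\<bar> \<le> 1" for k s
        proof -
          have "0 \<le> d k" using Suc.prems(2)[of 0 0 k] by simp
          have "\<bar>s\<bar> \<le> \<bar>t\<bar> + 1" using that by linarith
          moreover from this have "s\<^sup>2 \<le> (\<bar>t\<bar> + 1)\<^sup>2"
            using power_mono[of "\<bar>s\<bar>" "\<bar>t\<bar> + 1" 2] by simp
          ultimately have "1 + \<bar>s\<bar> + s\<^sup>2 \<le> A" by (simp add: A_def)
          then show ?thesis
            using Suc.prems(2)[of 1 s k] \<open>0 \<le> d k\<close> mult_right_mono order_trans by fastforce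
        qed
        show "weighted_l2 q (\<lambda>k. c k * complex_of_real (A * d k))"
          by (rule weighted_l2_comparison[OF sm, where A = "A\<^sup>2"])
             (simp add: norm_mult power_mult_distrib mult_ac)
      qed
    qed
    moreover have "C_sobolev P q (\<lambda>s. trig_series (\<lambda>k. c k * complex_of_real (u (Suc 0) s k)))"
      using Suc.IH[of "\<lambda>j. u (Suc j)"] Suc.prems by auto
    moreover have "trig_series (\<lambda>k. c k * complex_of_real (u 0 t k)) \<in> sobolev q" for t
      using Suc.prems(2)[of 0] by (intro sob) simp
    ultimately show ?case 
      by (auto intro!: exI[of _ "\<lambda>t. trig_series (\<lambda>k. c k * complex_of_real (u 1 t k))"])
  }
qed

lemma C_sobolev_Suc_D: "C_sobolev (Suc p) q T \<Longrightarrow> C_sobolev p q T"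
  by (induction p arbitrary: T) auto

lemma C_sobolev_mono: "p \<le> p' \<Longrightarrow> C_sobolev p' q T \<Longrightarrow> C_sobolev p q T"
  by (induction p' rule: dec_induct) (auto dest: C_sobolev_Suc_D simp del: C_sobolev.simps)

section \<open>Time profiles of the single modes and the regularity count\<close>

definition cosine_mode :: "real \<Rightarrow> nat \<Rightarrow> real \<Rightarrow> real" where
  "cosine_mode m j t =
     (let s = sqrt (- m) in if j = 0 then cos (s * t) - 1 else s ^ j * cos (s * t + real j * (pi / 2))) / m"

lemma sqrt_power2_eq_abs: "(sqrt x)\<^sup>2 = \<bar>x\<bar>"
  by (simp add: power2_eq_square flip: real_sqrt_mult)

text \<open>Each derivative of cos (s t) contributes a factor s and advances the phase by pi/2.
  Order 0 is a separate case because of the constant -1, which the first derivative removes.\<close>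

lemma cosine_mode_derivative:
  "(cosine_mode m j has_real_derivative cosine_mode m (Suc j) t) (at t)"
proof -
  define s where "s = sqrt (- m)"
  have shift: "cos (s * t + real (Suc j) * (pi / 2)) = - sin (s * t + real j * (pi / 2))"
  proof -
    have "s * t + real (Suc j) * (pi / 2) = (s * t + real j * (pi / 2)) + pi / 2"
      by (simp add: algebra_simps add_divide_distrib)
    then show ?thesis by (simp only: cos_add) simp
  qed
  have "((\<lambda>t. if j = 0 then cos (s * t) - 1 else s ^ j * cos (s * t + real j * (pi / 2)))
      has_real_derivative s ^ Suc j * (- sin (s * t + real j * (pi / 2)))) (at t)"
    by (cases "j = 0") (auto intro!: derivative_eq_intros)
  from DERIV_cdivide[OF this, of m]
  have "((\<lambda>t. (if j = 0 then cos (s * t) - 1 else s ^ j * cos (s * t + real j * (pi / 2))) / m)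
      has_real_derivative s ^ Suc j * (- sin (s * t + real j * (pi / 2))) / m) (at t)" .
  then show ?thesis
    unfolding cosine_mode_def s_def[symmetric] Let_def shift[symmetric] by simp
qed

text \<open>The bounds do not depend on the sign of \<open>m\<close>, since \<open>sqrt (- m)\<close> is odd in \<open>m\<close>;
  the factor \<open>1 / m\<close> is absorbed by \<open>1 - cos (s t) \<le> (s t)\<^sup>2 / 2\<close> and \<open>\<bar>sin (s t)\<bar> \<le> \<bar>s t\<bar>\<close>.\<close>

lemma abs_cosine_mode_le:
  assumes "j \<le> N + 2"
  shows "\<bar>cosine_mode m j t\<bar> \<le> (1 + \<bar>t\<bar> + t\<^sup>2) * (1 + \<bar>sqrt (- m)\<bar> ^ N)"
proof (cases "m = 0")
  case True
  \<comment> \<open>Division by zero yields 0, so the mode vanishes here.\<close>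
  then show ?thesis by (simp add: cosine_mode_def)
next
  case False
  define s where "s = sqrt (- m)"
  have m: "\<bar>m\<bar> = \<bar>s\<bar>\<^sup>2" by (simp add: s_def sqrt_power2_eq_abs)
  have s0: "\<bar>s\<bar> > 0" using False by (simp add: s_def)
  \<comment> \<open>Orders 0 and 1 carry the net powers s^(-2) and s^(-1), which are traded for
    powers of t. From order 2 on, s^2 cancels |m| and i = j - 2 powers of s remain.\<close>
  consider "j = 0" | "j = 1" | i where "j = i + 2" "i \<le> N"
    using assms by (metis One_nat_def add_2_eq_Suc' add_le_cancel_right not0_implies_Suc)
  then have "\<bar>cosine_mode m j t\<bar> \<le> t\<^sup>2 \<or> \<bar>cosine_mode m j t\<bar> \<le> \<bar>t\<bar> \<or> \<bar>cosine_mode m j t\<bar> \<le> 1 + \<bar>s\<bar> ^ N"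
  proof cases
    case 1
    have "\<bar>cos (s * t) - 1\<bar> = 2 * (sin (s * t / 2))\<^sup>2"
      using cos_double_sin[of "s * t / 2"] by simp
    also have "(sin (s * t / 2))\<^sup>2 \<le> (s * t / 2)\<^sup>2"
      using abs_sin_x_le_abs_x[of "s * t / 2"] unfolding abs_le_square_iff .
    finally have "\<bar>cos (s * t) - 1\<bar> \<le> \<bar>s\<bar>\<^sup>2 * t\<^sup>2 / 2"
      by (simp add: power_mult_distrib power_divide)
    also have "\<dots> \<le> \<bar>s\<bar>\<^sup>2 * t\<^sup>2" by simp
    finally have "\<bar>cos (s * t) - 1\<bar> \<le> \<bar>s\<bar>\<^sup>2 * t\<^sup>2" .
    then have "\<bar>cosine_mode m j t\<bar> \<le> t\<^sup>2"
      using 1 s0 by (simp add: cosine_mode_def m s_def[symmetric] Let_def divide_le_eq mult.commute del: power2_abs)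
    then show ?thesis by blast
  next
    case 2
    have "\<bar>cosine_mode m j t\<bar> = \<bar>s\<bar> * \<bar>sin (s * t)\<bar> / \<bar>s\<bar>\<^sup>2"
      using 2 by (simp add: cosine_mode_def m s_def[symmetric] Let_def cos_add abs_mult del: power2_abs)
    also have "\<dots> \<le> \<bar>s\<bar> * \<bar>s * t\<bar> / \<bar>s\<bar>\<^sup>2"
      by (intro divide_right_mono mult_left_mono abs_sin_x_le_abs_x) auto
    also have "\<dots> = \<bar>t\<bar>"
      using s0 by (simp only: abs_mult power2_eq_square mult.assoc[symmetric]) simp
    finally show ?thesis by blast
  next
    case 3
    have "\<bar>cosine_mode m j t\<bar> = \<bar>s ^ j * cos (s * t + real j * (pi / 2))\<bar> / \<bar>m\<bar>"
      using 3 by (simp only: cosine_mode_def s_def[symmetric] Let_def abs_divide) simp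
    also have "\<dots> = \<bar>s\<bar> ^ i * \<bar>cos (s * t + real j * (pi / 2))\<bar>"
      using s0 unfolding m abs_mult power_abs 3(1) power_add by (simp del: power2_abs)
    also have "\<dots> \<le> \<bar>s\<bar> ^ i * 1" by (intro mult_left_mono) auto
    \<comment> \<open>An intermediate power is at most the larger of the powers 0 and N, so the same
      majorant serves all orders.\<close>
    also have "\<bar>s\<bar> ^ i \<le> 1 + \<bar>s\<bar> ^ N"
    proof (cases "\<bar>s\<bar> \<le> 1")
      case True
      then have "\<bar>s\<bar> ^ i \<le> 1" by (intro power_le_one) auto
      then show ?thesis using zero_le_power[of "\<bar>s\<bar>" N] by linarith
    next
      case False
      then have "\<bar>s\<bar> ^ i \<le> \<bar>s\<bar> ^ N" using 3 by (intro power_increasing) auto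
      then show ?thesis by linarith
    qed
    finally show ?thesis by simp
  qed
  moreover have "1 * (1 + \<bar>s\<bar> ^ N) \<le> (1 + \<bar>t\<bar> + t\<^sup>2) * (1 + \<bar>s\<bar> ^ N)"
    by (intro mult_right_mono) (auto simp: add_nonneg_nonneg)
  moreover have B: "(1 + \<bar>t\<bar> + t\<^sup>2) * 1 \<le> (1 + \<bar>t\<bar> + t\<^sup>2) * (1 + \<bar>s\<bar> ^ N)"
    by (intro mult_left_mono) auto
  moreover have "t\<^sup>2 \<le> (1 + \<bar>t\<bar> + t\<^sup>2) * 1" "\<bar>t\<bar> \<le> (1 + \<bar>t\<bar> + t\<^sup>2) * 1" by simp_all
  ultimately show ?thesis
    unfolding s_def[symmetric] mult_1 by (elim disjE) (erule (1) order_trans | meson order_trans)+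
qed

text \<open>The derivatives of t^2/2, which is the limit of (cos (s t) - 1)/m with s = sqrt (-m) as
  m tends to 0 from below.\<close>

definition quadratic_mode :: "nat \<Rightarrow> real \<Rightarrow> real" where
  "quadratic_mode j t = (if j = 0 then t\<^sup>2 / 2 else if j = 1 then t else if j = 2 then 1 else 0)"

lemma quadratic_mode_derivative:
  "(quadratic_mode j has_real_derivative quadratic_mode (Suc j) t) (at t)"
proof -
  consider "j = 0" | "j = 1" | "j \<ge> 2" by linarith
  then show ?thesis
    by cases (auto simp: quadratic_mode_def[abs_def] intro!: derivative_eq_intros)
qed

lemma abs_quadratic_mode_le: "\<bar>quadratic_mode j t\<bar> \<le> 1 + \<bar>t\<bar> + t\<^sup>2"
  using zero_le_power2[of t] by (auto simp: quadratic_mode_def)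

text \<open>N counts the derivatives beyond the two free ones. Their cost |m|^(N/2) enters the
  Sobolev norm squared, as |m|^N <= C^N weight^(e N), so the index rises from q to q + e N.\<close>

lemma C_sobolev_solution:
  fixes b :: "'n::finite functional"
  assumes b: "b \<in> sobolev \<sigma>"
    and growth: "\<And>\<nu> :: real ^ 'n. \<bar>multiplier \<delta> \<beta> \<nu>\<bar> \<le> C * (1 + (norm \<nu>)\<^sup>2) powr e"
    and "C \<ge> 0" "e \<ge> 0" and le: "q + e * real N \<le> \<sigma>"
  shows "C_sobolev (N + 2) q (solution \<delta> \<beta> b)"
proof -
  define m where "m = (\<lambda>k::int ^ 'n. multiplier \<delta> \<beta> (real_vec k))"
  define u where "u = (\<lambda>j t k. if k = 0 then quadratic_mode j t else cosine_mode (m k) j t)"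
  define d where "d = (\<lambda>k. 1 + \<bar>sqrt (- m k)\<bar> ^ N)"
  have solution: "solution \<delta> \<beta> b = (\<lambda>t. trig_series (\<lambda>k. fourier_coeff b k * complex_of_real (u 0 t k)))"
    unfolding solution_def
    by (intro ext arg_cong2[where f = trig_series] refl)
       (simp add: u_def m_def quadratic_mode_def cosine_mode_def)
  show ?thesis unfolding solution
  proof (rule C_sobolev_trig_series)
    show "((\<lambda>s. u j s k) has_real_derivative u (Suc j) s k) (at s)" for j k s
      unfolding u_def by (cases "k = 0") (auto intro: quadratic_mode_derivative cosine_mode_derivative)
    show "\<bar>u j s k\<bar> \<le> (1 + \<bar>s\<bar> + s\<^sup>2) * d k" if "j \<le> N + 2" for j s k
    proof (cases "k = 0")
      case True
      have "(1 + \<bar>s\<bar> + s\<^sup>2) * 1 \<le> (1 + \<bar>s\<bar> + s\<^sup>2) * d k"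
        by (intro mult_left_mono) (auto simp: d_def)
      then show ?thesis using True abs_quadratic_mode_le[of j s] by (simp add: u_def)
    next
      case False
      then show ?thesis using abs_cosine_mode_le[OF that, of "m k" s] by (simp add: u_def d_def)
    qed
    have "weighted_l2 \<sigma> (fourier_coeff b)"
      using b by (simp add: sobolev_def weighted_l2_def)
    then show "weighted_l2 q (\<lambda>k. fourier_coeff b k * complex_of_real (d k))"
    proof (rule weighted_l2_comparison)
      fix k :: "int ^ 'n"
      have W: "1 \<le> weight k" by simp
      have "(\<bar>sqrt (- m k)\<bar> ^ N)\<^sup>2 = \<bar>m k\<bar> ^ N"
      proof -
        have "(\<bar>sqrt (- m k)\<bar> ^ N)\<^sup>2 = (\<bar>sqrt (- m k)\<bar>\<^sup>2) ^ N"
          by (simp only: power_mult[symmetric] mult.commute)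
        also have "\<bar>sqrt (- m k)\<bar>\<^sup>2 = \<bar>m k\<bar>" by (simp add: sqrt_power2_eq_abs)
        finally show ?thesis .
      qed
      also have "\<dots> \<le> (C * weight k powr e) ^ N"
        unfolding m_def by (intro power_mono growth) auto
      also have "\<dots> = C ^ N * weight k powr (e * real N)"
      proof -
        have "0 < weight k powr e" using ge_one_powr_ge_zero[OF W \<open>e \<ge> 0\<close>] by linarith
        then show ?thesis
          unfolding power_mult_distrib powr_powr[symmetric] by (simp only: powr_realpow)
      qed
      finally have sq: "(\<bar>sqrt (- m k)\<bar> ^ N)\<^sup>2 \<le> C ^ N * weight k powr (e * real N)" .
      \<comment> \<open>This is (1 + y)^2 <= 2 (1 + y^2).\<close>
      have "(d k)\<^sup>2 \<le> 2 * (1 + (\<bar>sqrt (- m k)\<bar> ^ N)\<^sup>2)"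
        using sum_squares_bound[of 1 "\<bar>sqrt (- m k)\<bar> ^ N"] by (simp add: d_def power2_sum)
      also have "\<dots> \<le> 2 * (weight k powr (e * real N) + C ^ N * weight k powr (e * real N))"
        using sq W \<open>e \<ge> 0\<close> ge_one_powr_ge_zero[OF W, of "e * real N"] by simp
      finally have d: "(d k)\<^sup>2 \<le> 2 * (1 + C ^ N) * weight k powr (e * real N)"
        by (simp add: algebra_simps)
      have "weight k powr q * (norm (fourier_coeff b k * complex_of_real (d k)))\<^sup>2
          = weight k powr q * (d k)\<^sup>2 * (norm (fourier_coeff b k))\<^sup>2"
        by (simp add: norm_mult power_mult_distrib)
      also have "\<dots> \<le> weight k powr q * (2 * (1 + C ^ N) * weight k powr (e * real N)) * (norm (fourier_coeff b k))\<^sup>2"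
        by (intro mult_right_mono mult_left_mono d) auto
      also have "\<dots> = 2 * (1 + C ^ N) * (weight k powr (q + e * real N) * (norm (fourier_coeff b k))\<^sup>2)"
        by (simp only: powr_add mult_ac)
      also have "\<dots> \<le> 2 * (1 + C ^ N) * (weight k powr \<sigma> * (norm (fourier_coeff b k))\<^sup>2)"
        using \<open>C \<ge> 0\<close> W le by (intro mult_left_mono mult_right_mono powr_mono) auto
      finally show "weight k powr q * (norm (fourier_coeff b k * complex_of_real (d k)))\<^sup>2
          \<le> 2 * (1 + C ^ N) * (weight k powr \<sigma> * (norm (fourier_coeff b k))\<^sup>2)" .
    qed
  qed
qed

theorem theorem16:
  fixes b :: "'n::finite functional" and \<delta> \<beta> \<sigma> :: real
  assumes "\<delta> > 0" and "\<beta> < real CARD('n) + 4" and "b \<in> sobolev \<sigma>"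
  shows "(\<beta> < real CARD('n) \<longrightarrow> (\<forall>q\<le>\<sigma>. C_infinity_sobolev q (solution \<delta> \<beta> b))) \<and>
         (\<beta> = real CARD('n) \<longrightarrow> (\<forall>q<\<sigma>. C_infinity_sobolev q (solution \<delta> \<beta> b))) \<and>
         (\<beta> > real CARD('n) \<longrightarrow>
            (\<forall>q. \<forall>p::nat. p > 0 \<longrightarrow> q - \<sigma> + (real p - 1) * ((\<beta> - real CARD('n)) / 2) \<le> 0 \<longrightarrow>
               C_sobolev (p + 1) q (solution \<delta> \<beta> b)))"
proof -
  have regularity: "C_sobolev p q (solution \<delta> \<beta> b)"
    if e: "e \<ge> 0" "e \<ge> (\<beta> - real CARD('n)) / 2" "\<beta> = real CARD('n) \<Longrightarrow> e > 0"
      and le: "q + e * real N \<le> \<sigma>" and "p \<le> N + 2" for e q N p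
  proof -
    obtain C where "C \<ge> 0" "\<And>\<nu> :: real ^ 'n. \<bar>multiplier \<delta> \<beta> \<nu>\<bar> \<le> C * (1 + (norm \<nu>)\<^sup>2) powr e"
      using multiplier_growth[OF assms(1,2) e] by blast
    then have "C_sobolev (N + 2) q (solution \<delta> \<beta> b)"
      using assms(3) e(1) le by (intro C_sobolev_solution)
    then show ?thesis using \<open>p \<le> N + 2\<close> C_sobolev_mono by blast
  qed
  show ?thesis
  proof (intro conjI impI allI)
    fix q assume "\<beta> < real CARD('n)" "q \<le> \<sigma>"
    \<comment> \<open>With e = 0 the multipliers are bounded and further derivatives are free, so q
      = \<sigma> is allowed for every N.\<close>
    then have "C_sobolev p q (solution \<delta> \<beta> b)" for p
      by (intro regularity[where e = 0 and N = p]) auto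
    then show "C_infinity_sobolev q (solution \<delta> \<beta> b)"
      by (simp add: C_infinity_sobolev_def)
  next
    fix q assume \<beta>: "\<beta> = real CARD('n)" and q: "q < \<sigma>"
    show "C_infinity_sobolev q (solution \<delta> \<beta> b)"
      unfolding C_infinity_sobolev_def
    proof
      fix p
      \<comment> \<open>The gap \<sigma> - q is shared among p derivatives, so e depends on p; the
        summand 1 keeps the denominator positive at p = 0.\<close>
      let ?e = "(\<sigma> - q) / (real p + 1)"
      have "?e * real p \<le> ?e * (real p + 1)" using q by (intro mult_left_mono) auto
      also have "\<dots> = \<sigma> - q" by simp
      finally have "q + ?e * real p \<le> \<sigma>" by simp
      then show "C_sobolev p q (solution \<delta> \<beta> b)"
        using \<beta> q by (intro regularity[of ?e q p]) simp_all
    qed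
  next
    fix q and p :: nat
    let ?e = "(\<beta> - real CARD('n)) / 2"
    assume \<beta>: "\<beta> > real CARD('n)" and p: "p > 0" and le: "q - \<sigma> + (real p - 1) * ?e \<le> 0"
    \<comment> \<open>N = p - 1 gives N + 2 = p + 1 derivatives; p > 0 makes the natural-number
      subtraction exact.\<close>
    have "real (p - 1) = real p - 1" using p by (simp add: of_nat_diff)
    then have "?e * real (p - 1) = (real p - 1) * ?e" by (simp only: mult.commute)
    then have "q + ?e * real (p - 1) \<le> \<sigma>" using le by linarith
    then show "C_sobolev (p + 1) q (solution \<delta> \<beta> b)"
      using \<beta> p by (intro regularity[of ?e q "p - 1"]) simp_all
  qed
qed

end
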